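(* Let $\beta\in(0,1)$, let $\{L(t)\}_{t\ge0}$ be the Lévy Walk limit process in $\mathbb R^m$ with tail parameter $\beta$ and spectral measure $\lambda$ (defined in the context), and let $\rho_t(x)$ be the Lebesgue density of the law of $L(t)$, $t>0$. Then $\rho_t(x)$ satisfies the pseudo-differential equation on $\mathbb R^{m+1}$ $$\int_{S^{m-1}}\bigl(\partial_t+\langle\theta,\nabla_x\rangle\bigr)^\beta\rho_t(x)\,\lambda(d\theta)=\frac{t^{-\beta}}{\Gamma(1-\beta)}\,\delta(\|x\|-t)\,\lambda\Bigl(d\frac{x}{\|x\|}\Bigr)$$ in the mild sense. Here the right-hand side denotes the family of measures $h(dx,t)=\frac{t^{-\beta}}{\Gamma(1-\beta)}\int_{S^{m-1}}\delta_{t\theta}(dx)\,\lambda(d\theta)$, $t>0$. That is, for all $k\in\mathbb R^m$ and $s>0$, $$\left(\int_{S^{m-1}}\bigl(s-i\langle k,\theta\rangle\bigr)^\beta\lambda(d\theta)\right)\int_0^\infty e^{-st}\int_{\mathbb R^m}e^{i\langle k,x\rangle}\rho_t(x)\,dx\,dt=\int_0^\infty e^{-st}\int_{\mathbb R^m}e^{i\langle k,x\rangle}\,h(dx,t)\,dt .$$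
   Context: $S^{m-1}$ is the Euclidean unit sphere of $\mathbb R^m$ and $\lambda$ is a probability measure on $S^{m-1}$ whose support spans $\mathbb R^m$. $\{(A(t),D(t))\}_{t\ge0}$ is the Lévy process in $\mathbb R^m\times\mathbb R_+$ with $\mathbf E[e^{-sD(t)+i\langle k,A(t)\rangle}]=e^{-t\psi(k,s)}$, $\psi(k,s)=\int_{S^{m-1}}(s-i\langle k,\theta\rangle)^\beta\,\lambda(d\theta)$, $k\in\mathbb R^m$, $s\ge0$ (principal branch). For a path $x$ that is right-continuous with left limits, $x^-(t)=x(t-)$ for $t>0$ and $x^-(0)=x(0)$. Put $\mathcal R(D)=\{D(t):t\ge0\}$, $E(t)=\inf\{r\ge 0:D(r)>t\}$, $X(t)=\lim_{s\downarrow t}A^-(E(s))$, $Y(t)=A(E(t))$, $G(t)=\lim_{s\downarrow t}D^-(E(s))$, $H(t)=D(E(t))$. The Lévy Walk limit process is $$L(t)=X(t)\ \text{ if } t\in\mathcal R(D),\qquad L(t)=X(t)+\frac{t-G(t)}{H(t)-G(t)}(Y(t)-X(t))\ \text{ if } t\notin\mathcal R(D).$$ The existence of the density $\rho_t(x)$ of the law of $L(t)$ for each $t>0$ is part of the setting. Mild solutions: the Fourier–Laplace transform of a family of bounded measures $\mu_t(dx)$ is $\int_0^\infty e^{-st}\int_{\mathbb R^m}e^{i\langle k,x\rangle}\mu_t(dx)\,dt$. The operator $\int_{S^{m-1}}(\partial_t+\langle\theta,\nabla_x\rangle)^\beta\lambda(d\theta)$ has Fourier–Laplace symbol $\psi(k,s)$.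 Given a weakly measurable family $h(dx,t)$ of bounded measures on $\mathbb R^m$, a family $\rho_t(dx)$ of probability measures is the mild solution of the pseudo-differential equation with this operator and right-hand side $h$ if its Fourier–Laplace transform solves the corresponding algebraic equation, i.e. $\psi(k,s)$ times the transform of $\rho$ equals the transform of $h$. *)

theory Defs
  imports "HOL-Probability.Probability"
begin

text \<open>
  Paths and processes are indexed by \<open>real\<close>; only their values at times \<open>t \<ge> 0\<close> are ever used.
\<close>

definition cadlag :: "(real \<Rightarrow> 'b::topological_space) \<Rightarrow> bool" where
  "cadlag x \<longleftrightarrow>
     (\<forall>t\<ge>0. (x \<longlongrightarrow> x t) (at_right t)) \<and> (\<forall>t>0. \<exists>l. (x \<longlongrightarrow> l) (at_left t))"

definition (in prob_space) levy_process :: "(real \<Rightarrow> 'a \<Rightarrow> 'b::euclidean_space) \<Rightarrow> bool" where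
  "levy_process Z \<longleftrightarrow>
     (\<forall>t\<ge>0. random_variable borel (Z t)) \<and>
     (AE \<omega> in M. Z 0 \<omega> = 0) \<and>
     (\<forall>n. \<forall>\<tau>::nat \<Rightarrow> real. 0 \<le> \<tau> 0 \<longrightarrow> incseq \<tau> \<longrightarrow>
        indep_vars (\<lambda>_. borel) (\<lambda>i \<omega>. Z (\<tau> (Suc i)) \<omega> - Z (\<tau> i) \<omega>) {..<n}) \<and>
     (\<forall>r\<ge>0. \<forall>t\<ge>0. distr M borel (\<lambda>\<omega>. Z (r + t) \<omega> - Z r \<omega>) = distr M borel (Z t)) \<and>
     (\<forall>t\<ge>0. \<forall>\<epsilon>>0.
        ((\<lambda>r. prob {\<omega> \<in> space M. \<epsilon> < dist (Z r \<omega>) (Z t \<omega>)}) \<longlongrightarrow> 0) (at t within {0..})) \<and>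
     (AE \<omega> in M. cadlag (\<lambda>t. Z t \<omega>))"

text \<open>Complex \<open>powr\<close> is the principal branch.\<close>

definition walk_symbol :: "real \<Rightarrow> 'b::euclidean_space measure \<Rightarrow> 'b \<Rightarrow> real \<Rightarrow> complex" where
  "walk_symbol \<beta> \<Lambda> k s =
     (LINT \<theta>|\<Lambda>. (complex_of_real s - \<i> * complex_of_real (k \<bullet> \<theta>)) powr complex_of_real \<beta>)"

definition measure_support :: "'b::topological_space measure \<Rightarrow> 'b set" where
  "measure_support \<mu> =
     {x \<in> space \<mu>. \<forall>U. open U \<longrightarrow> x \<in> U \<longrightarrow> emeasure \<mu> (U \<inter> space \<mu>) > 0}"

definition left_version :: "(real \<Rightarrow> 'b::t2_space) \<Rightarrow> real \<Rightarrow> 'b" where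
  "left_version x t = (if t > 0 then Lim (at_left t) x else x 0)"

definition passage_time :: "(real \<Rightarrow> real) \<Rightarrow> real \<Rightarrow> real" where
  "passage_time d t = Inf {r. 0 \<le> r \<and> t < d r}"

text \<open>
  \<open>pre_passage x d t\<close> is the limit of \<open>x\<^sup>-(E(s))\<close> as \<open>s\<close> decreases to \<open>t\<close>: it gives \<open>X(t)\<close> for \<open>x = a\<close>
  and \<open>G(t)\<close> for \<open>x = d\<close>. Likewise \<open>post_passage\<close> gives \<open>Y(t)\<close> and \<open>H(t)\<close>.
\<close>

definition pre_passage :: "(real \<Rightarrow> 'b::t2_space) \<Rightarrow> (real \<Rightarrow> real) \<Rightarrow> real \<Rightarrow> 'b" where
  "pre_passage x d t = Lim (at_right t) (\<lambda>s. left_version x (passage_time d s))"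

definition post_passage :: "(real \<Rightarrow> 'b) \<Rightarrow> (real \<Rightarrow> real) \<Rightarrow> real \<Rightarrow> 'b" where
  "post_passage x d t = x (passage_time d t)"

definition levy_walk :: "(real \<Rightarrow> 'b::real_normed_vector) \<Rightarrow> (real \<Rightarrow> real) \<Rightarrow> real \<Rightarrow> 'b" where
  "levy_walk a d t =
     (let X = pre_passage a d t; Y = post_passage a d t;
          G = pre_passage d d t; H = post_passage d d t
      in if t \<in> d ` {0..} then X else X + ((t - G) / (H - G)) *\<^sub>R (Y - X))"

definition fourier_transform :: "'b::euclidean_space measure \<Rightarrow> 'b \<Rightarrow> complex" where
  "fourier_transform \<mu> k = (LINT x|\<mu>. exp (\<i> * complex_of_real (k \<bullet> x)))"

definition fourier_laplace ::
  "(real \<Rightarrow> 'b::euclidean_space measure) \<Rightarrow> 'b \<Rightarrow> real \<Rightarrow> complex" where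
  "fourier_laplace \<mu> k s =
     (LINT t:{0<..}|lborel. complex_of_real (exp (- s * t)) * fourier_transform (\<mu> t) k)"

definition fourier_laplace_exists ::
  "(real \<Rightarrow> 'b::euclidean_space measure) \<Rightarrow> 'b \<Rightarrow> real \<Rightarrow> bool" where
  "fourier_laplace_exists \<mu> k s \<longleftrightarrow>
     set_integrable lborel {0<..}
       (\<lambda>t. complex_of_real (exp (- s * t)) * fourier_transform (\<mu> t) k)"

definition weakly_measurable_family :: "(real \<Rightarrow> 'b::euclidean_space measure) \<Rightarrow> bool" where
  "weakly_measurable_family \<mu> \<longleftrightarrow>
     (\<forall>t>0. sets (\<mu> t) = sets borel \<and> finite_measure (\<mu> t)) \<and>
     (\<forall>f::'b \<Rightarrow> real. continuous_on UNIV f \<longrightarrow> bounded (range f) \<longrightarrow>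
        (\<lambda>t. LINT x|\<mu> t. f x) \<in> borel_measurable (restrict_space borel {0<..}))"

text \<open>
  The operator enters only through its Fourier-Laplace symbol \<open>\<Psi>\<close>. Existence of both transforms is
  required so that the equation never compares the default value of a divergent integral.
\<close>

definition mild_solution ::
  "('b::euclidean_space \<Rightarrow> real \<Rightarrow> complex) \<Rightarrow> (real \<Rightarrow> 'b measure) \<Rightarrow> (real \<Rightarrow> 'b measure) \<Rightarrow> bool"
  where
  "mild_solution \<Psi> h \<mu> \<longleftrightarrow>
     weakly_measurable_family h \<and>
     (\<forall>t>0. sets (\<mu> t) = sets borel \<and> prob_space (\<mu> t)) \<and>
     (\<forall>k. \<forall>s>0.
        fourier_laplace_exists \<mu> k s \<and> fourier_laplace_exists h k s \<and>
        \<Psi> k s * fourier_laplace \<mu> k s = fourier_laplace h k s)"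

text \<open>
  The right-hand side of the equation, for \<open>t > 0\<close>. The monadic bind \<open>\<Lambda> \<bind> (\<lambda>\<theta>. return borel (t *\<^sub>R \<theta>))\<close> is
  the mixture of the point masses at \<open>t\<theta>\<close> with mixing law \<open>\<Lambda>\<close>.
\<close>

definition walk_rhs :: "real \<Rightarrow> 'b::euclidean_space measure \<Rightarrow> real \<Rightarrow> 'b measure" where
  "walk_rhs \<beta> \<Lambda> t =
     scale_measure (ennreal (t powr (- \<beta>) / Gamma (1 - \<beta>)))
       (\<Lambda> \<bind> (\<lambda>\<theta>. return borel (t *\<^sub>R \<theta>)))"

end

theory Submission
  imports Defs "HOL-Real_Asymp.Real_Asymp"
begin

text \<open>
  Write \<open>\<phi>(k,s) = \<integral> (s - i\<langle>k,\<theta>\<rangle>)\<^bsup>\<beta>-1\<^esup> \<Lambda>(d\<theta>)\<close>. This is the Fourier-Laplace transform of the right-hand side,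
  because \<open>\<integral>\<^sub>0\<^sup>\<infinity> t\<^bsup>-\<beta>\<^esup> e\<^bsup>-ct\<^esup> dt = \<Gamma>(1-\<beta>) c\<^bsup>\<beta>-1\<^esup>\<close> also for complex \<open>c\<close> with positive real part
  (\<open>Gamma_integral_rate\<close>). So the transform of the law of \<open>L(t)\<close> has to be \<open>\<phi>/\<psi>\<close>.

  Approximate the walk by the polygon that runs linearly in \<open>t\<close> between the points
  \<open>(D(jh), A(jh))\<close>, \<open>h = 2\<^sup>-\<^sup>n\<close>. Its transform can be computed without any knowledge of the jumps of
  \<open>(A,D)\<close>. The chord from \<open>jh\<close> to \<open>(j+1)h\<close> contributes
  \<open>e\<^bsup>-sD(jh) + i\<langle>k,A(jh)\<rangle>\<^esup>\<close> times \<open>g\<close> of the next increment, where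
  \<open>g(a,d) = \<integral>\<^sub>0\<^sup>d e\<^bsup>-sv + i(v/d)\<langle>k,a\<rangle>\<^esup> dv = \<integral>\<^sub>0\<^sup>1 d e\<^bsup>-y(sd - i\<langle>k,a\<rangle>)\<^esup> dy\<close>; by independence and stationarity its
  expectation is \<open>e\<^bsup>-jh\<psi>\<^esup> E g(A(h),D(h))\<close>, and summation over \<open>j\<close> gives
  \<open>E g(A(h),D(h)) / (1 - e\<^bsup>-h\<psi>\<^esup>)\<close> (\<open>skeleton_renewal\<close>). For the numerator, the factor \<open>d\<close> is produced by
  differentiating \<open>E e\<^bsup>-sD(h) + i\<langle>k,A(h)\<rangle>\<^esup> = e\<^bsup>-h\<psi>(k,s)\<^esup>\<close> in \<open>s\<close>, and \<open>\<psi>(yk,ys) = y\<^sup>\<beta> \<psi>(k,s)\<close>, hence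
  \<open>E g = \<integral>\<^sub>0\<^sup>1 h\<beta>y\<^bsup>\<beta>-1\<^esup> \<phi> e\<^bsup>-hy\<^sup>\<beta>\<psi>\<^esup> dy = \<phi> (1 - e\<^bsup>-h\<psi>\<^esup>)/\<psi>\<close> (\<open>excursion_moment\<close>). The two factors
  \<open>1 - e\<^bsup>-h\<psi>\<^esup>\<close> cancel: every polygon has the transform \<open>\<phi>/\<psi>\<close>, and it only remains to let \<open>n\<close> tend to
  infinity.

  If \<open>D\<close> jumps over \<open>t\<close>, the end points of the chord above \<open>t\<close> converge to the two sides of the jump, and
  the polygon converges to \<open>L(t)\<close> (\<open>levy_walk_off_range\<close>). Otherwise \<open>D(E(t)) = t\<close>. These exceptional
  pairs \<open>(t,\<omega>)\<close> form a null set, since \<open>D\<close> has no drift: the same renewal argument gives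
  \<open>E \<integral> e\<^bsup>-t\<^esup> e\<^bsup>-\<sigma>(D(E(t)) - t)\<^esup> dt = (\<sigma>\<^sup>\<beta> - 1)/(\<sigma> - 1)\<close>, which tends to \<open>0\<close> as \<open>\<sigma> \<rightarrow> \<infinity>\<close>
  (\<open>overshoot_transform\<close>, \<open>overshoot_ne\<close>). Dominated convergence concludes.

  Two points need care. The density is given for each \<open>t\<close> separately, while the transform integrates a
  Borel function of \<open>t\<close>; therefore \<open>L(t)\<close> is written as a limit of dyadic expressions for every
  \<open>t \<ge> 0\<close>, also when \<open>D(E(t)) = t\<close>, where \<open>L(t) = A(E(t))\<close>. And the paths are regular only almost surely; they are
  replaced on a null set (\<open>regular_modification\<close>).
\<close>

section \<open>Differentiation under the integral and the Gamma integral\<close>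

lemma has_vector_derivative_within_iff_tendsto:
  fixes f :: "real \<Rightarrow> 'a::real_normed_vector"
  shows "(f has_vector_derivative f') (at x within S) \<longleftrightarrow>
     ((\<lambda>y. (1 / (y - x)) *\<^sub>R (f y - f x)) \<longlongrightarrow> f') (at x within S)"
proof -
  have "norm (f y - f x - (y - x) *\<^sub>R f') / norm (y - x) = norm ((1 / (y - x)) *\<^sub>R (f y - f x) - f')"
    if "y \<noteq> x" for y
  proof -
    have "(1 / (y - x)) *\<^sub>R (f y - f x) - f' = (1 / (y - x)) *\<^sub>R (f y - f x - (y - x) *\<^sub>R f')"
      using that by (simp add: scaleR_diff_right)
    then show ?thesis by (simp add: divide_inverse mult.commute)
  qed
  then have "((\<lambda>y. norm (f y - f x - (y - x) *\<^sub>R f') / norm (y - x)) \<longlongrightarrow> 0) (at x within S) \<longleftrightarrow>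
      ((\<lambda>y. norm ((1 / (y - x)) *\<^sub>R (f y - f x) - f')) \<longlongrightarrow> 0) (at x within S)"
    by (intro filterlim_cong) (auto simp: eventually_at_filter)
  then show ?thesis
    by (simp add: has_vector_derivative_def has_derivative_iff_norm tendsto_norm_zero_iff
        bounded_linear_scaleR_left LIM_zero_iff)
qed

text \<open>
  The mean value inequality bounds the difference quotients by \<open>g\<close>, so that dominated convergence
  applies along every sequence tending to \<open>x0\<close>.
\<close>

lemma has_vector_derivative_lebesgue_integral:
  fixes f f' :: "real \<Rightarrow> 'a \<Rightarrow> complex"
  assumes S: "convex S" "x0 \<in> S"
    and int: "\<And>x. x \<in> S \<Longrightarrow> integrable M (f x)"
    and meas: "f' x0 \<in> borel_measurable M"
    and der: "\<And>x y. x \<in> S \<Longrightarrow> y \<in> space M \<Longrightarrow>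
                ((\<lambda>x. f x y) has_vector_derivative f' x y) (at x within S)"
    and bound: "\<And>x y. x \<in> S \<Longrightarrow> y \<in> space M \<Longrightarrow> norm (f' x y) \<le> g y"
    and g: "integrable M g"
  shows "((\<lambda>x. LINT y|M. f x y) has_vector_derivative (LINT y|M. f' x0 y)) (at x0 within S)"
proof -
  have "((\<lambda>x. (1 / (x - x0)) *\<^sub>R ((LINT y|M. f x y) - (LINT y|M. f x0 y))) \<longlongrightarrow> (LINT y|M. f' x0 y))
          (at x0 within S)"
    unfolding tendsto_at_iff_sequentially comp_def
  proof (intro allI impI)
    fix X :: "nat \<Rightarrow> real" assume X: "\<forall>i. X i \<in> S - {x0}" and lim: "X \<longlonglongrightarrow> x0"
    define Q where "Q i y = (1 / (X i - x0)) *\<^sub>R (f (X i) y - f x0 y)" for i y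
    have eq: "(1 / (X i - x0)) *\<^sub>R ((LINT y|M. f (X i) y) - (LINT y|M. f x0 y)) = (LINT y|M. Q i y)" for i
      unfolding Q_def using X S(2) int by (simp add: Bochner_Integration.integral_diff)
    have "(\<lambda>i. LINT y|M. Q i y) \<longlonglongrightarrow> (LINT y|M. f' x0 y)"
    proof (rule integral_dominated_convergence[where w=g])
      show "Q i \<in> borel_measurable M" for i
        using int[of "X i"] int[of x0] X S(2) unfolding Q_def by auto
      show "AE y in M. (\<lambda>i. Q i y) \<longlonglongrightarrow> f' x0 y"
      proof (rule AE_I2)
        fix y assume y: "y \<in> space M"
        have "((\<lambda>x. (1 / (x - x0)) *\<^sub>R (f x y - f x0 y)) \<longlongrightarrow> f' x0 y) (at x0 within S)"
          using der[OF S(2) y] by (simp add: has_vector_derivative_within_iff_tendsto)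
        then show "(\<lambda>i. Q i y) \<longlonglongrightarrow> f' x0 y"
          using X lim unfolding tendsto_at_iff_sequentially comp_def Q_def by blast
      qed
      show "AE y in M. norm (Q i y) \<le> g y" for i
      proof (rule AE_I2)
        fix y assume y: "y \<in> space M"
        have "norm (f (X i) y - f x0 y) \<le> g y * norm (X i - x0)"
        proof (rule differentiable_bound[OF S(1)])
          show "\<And>x. x \<in> S \<Longrightarrow> ((\<lambda>x. f x y) has_derivative (\<lambda>h. h *\<^sub>R f' x y)) (at x within S)"
            using der[OF _ y] by (simp add: has_vector_derivative_def)
          show "onorm (\<lambda>h. h *\<^sub>R f' x y) \<le> g y" if "x \<in> S" for x
            by (rule onorm_le) (use bound[OF that y] in \<open>auto simp: mult.commute intro: mult_left_mono\<close>)
        qed (use X S in auto)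
        then show "norm (Q i y) \<le> g y"
          using X by (auto simp: Q_def divide_simps)
      qed
    qed (use meas g in auto)
    then show "(\<lambda>i. (1 / (X i - x0)) *\<^sub>R ((LINT y|M. f (X i) y) - (LINT y|M. f x0 y)))
                 \<longlonglongrightarrow> (LINT y|M. f' x0 y)"
      by (simp add: eq)
  qed
  then show ?thesis
    by (simp add: has_vector_derivative_within_iff_tendsto)
qed

lemma has_vector_derivative_exp_affine:
  fixes a b :: complex
  shows "((\<lambda>x. exp (a * of_real x + b)) has_vector_derivative a * exp (a * of_real x + b)) (at x within S)"
proof -
  have "((\<lambda>z. exp (a * z + b)) has_field_derivative a * exp (a * of_real x + b)) (at (of_real x))"
    by (auto intro!: derivative_eq_intros)
  then show ?thesis by (rule has_vector_derivative_real_field)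
qed

lemma has_vector_derivative_powr_affine:
  fixes a b :: complex
  assumes "0 < Re (a * of_real x + b)"
  shows "((\<lambda>x. (a * of_real x + b) powr p) has_vector_derivative
            p * (a * of_real x + b) powr (p - 1) * a) (at x within S)"
proof -
  have "a * of_real x + b \<notin> \<real>\<^sub>\<le>\<^sub>0"
    using assms by (auto simp: complex_nonpos_Reals_iff)
  then have "((\<lambda>z. (a * z + b) powr p) has_field_derivative p * (a * of_real x + b) powr (p - 1) * a)
      (at (of_real x))"
    by (intro DERIV_chain2[OF has_field_derivative_powr]) (auto intro!: derivative_eq_intros)
  then show ?thesis by (rule has_vector_derivative_real_field)
qed

lemma powr_of_real_mult:
  fixes z :: complex
  assumes "r > 0"
  shows "(of_real r * z) powr of_real p = of_real (r powr p) * z powr of_real p"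
proof (cases "z = 0")
  case False
  then show ?thesis using assms
    by (simp add: powr_def Ln_times_of_real Ln_of_real exp_add distrib_left flip: exp_of_real)
qed auto

lemma norm_powr_le:
  fixes z :: complex
  assumes "0 < s" "s \<le> Re z" "p \<le> 0"
  shows "norm (z powr of_real p) \<le> s powr p"
proof -
  have "s \<le> norm z" using assms complex_Re_le_cmod[of z] by linarith
  then show ?thesis
    using assms by (simp add: norm_powr_real_powr' powr_mono2')
qed

lemma set_integrable_Gamma_rate:
  assumes z: "0 < z" and c: "0 < Re c"
  shows "set_integrable lborel {0<..} (\<lambda>t. of_real (t powr (z - 1)) * exp (- (c * of_real t)))"
proof -
  have "set_integrable lebesgue {0<..} (\<lambda>t. complex_of_real t powr (of_real z - 1) / of_real (exp (Re c * t)))"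
    using absolutely_integrable_Gamma_integral[of "of_real z" "Re c"] z c by simp
  moreover have "complex_of_real t powr (of_real z - 1) = of_real (t powr (z - 1))" if "t > 0" for t
    using that powr_of_real[of t "z - 1"] by simp
  ultimately have "set_integrable lebesgue {0<..} (\<lambda>t. complex_of_real (t powr (z - 1) * exp (- (Re c * t))))"
    by (subst set_integrable_cong[OF refl refl]) (auto simp: exp_minus field_simps)
  then have "set_integrable lborel {0<..} (\<lambda>t. complex_of_real (t powr (z - 1) * exp (- (Re c * t))))"
    unfolding set_integrable_def by (subst (asm) integrable_completion) auto
  then show ?thesis
    unfolding set_integrable_def
    by (rule Bochner_Integration.integrable_bound)
       (auto simp: norm_mult split: split_indicator)
qed

lemma set_integral_Gamma_parts:
  assumes z: "0 < z" and c: "0 < Re c"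
  shows "c * (LINT t:{0<..}|lborel. of_real (t powr z) * exp (- (c * of_real t))) =
         of_real z * (LINT t:{0<..}|lborel. of_real (t powr (z - 1)) * exp (- (c * of_real t)))"
proof -
  define F where "F t = complex_of_real (t powr z) * exp (- (c * of_real t))" for t
  define f1 where "f1 t = complex_of_real (t powr (z - 1)) * exp (- (c * of_real t))" for t
  define f where "f t = of_real z * f1 t - c * F t" for t
  have norm_F: "norm (F t) = t powr z * exp (- (Re c * t))" for t
    by (simp add: F_def norm_mult)
  have i1: "set_integrable lborel {0<..} f1"
    unfolding f1_def by (rule set_integrable_Gamma_rate[OF z c])
  have i2: "set_integrable lborel {0<..} F"
    using set_integrable_Gamma_rate[of "z + 1" c] z c unfolding F_def by simp
  have int: "set_integrable lborel {0<..} f"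
    unfolding f_def using i1 i2 by (intro set_integral_diff set_integrable_mult_right) auto
  have "(LBINT x=0..\<infinity>. f x) = 0 - 0"
  proof (rule interval_integral_FTC_integrable[where F=F])
    show "(F has_vector_derivative f x) (at x)" if "0 < ereal x" for x
    proof -
      have x: "x > 0" using that by simp
      show ?thesis unfolding F_def f_def f1_def
        using has_vector_derivative_exp_affine[of "- c" 0 x UNIV] x
        by (auto intro!: derivative_eq_intros simp: algebra_simps)
    qed
    show "isCont f x" if "0 < ereal x" for x
      using that unfolding f_def F_def f1_def by (auto intro!: continuous_intros)
    show "set_integrable lborel (einterval 0 \<infinity>) f"
      using int by (simp add: zero_ereal_def)
    have "((\<lambda>t. t powr z * exp (- (Re c * t))) \<longlongrightarrow> 0) (at_right 0)"
      using z c by real_asymp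
    then show "((F \<circ> real_of_ereal) \<longlongrightarrow> 0) (at_right 0)"
      unfolding zero_ereal_def by (simp add: ereal_tendsto_simps tendsto_norm_zero_iff flip: norm_F)
    have "((\<lambda>t. t powr z * exp (- (Re c * t))) \<longlongrightarrow> 0) at_top"
      using z c by real_asymp
    then show "((F \<circ> real_of_ereal) \<longlongrightarrow> 0) (at_left \<infinity>)"
      by (simp add: ereal_tendsto_simps tendsto_norm_zero_iff flip: norm_F)
  qed simp
  then have "(LINT t:{0<..}|lborel. f t) = 0"
    by (simp add: interval_lebesgue_integral_0_infty)
  also have "(LINT t:{0<..}|lborel. f t) = of_real z * (LINT t:{0<..}|lborel. f1 t) - c * (LINT t:{0<..}|lborel. F t)"
    unfolding f_def using i1 i2 by (subst set_integral_diff) auto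
  finally show ?thesis by (simp add: F_def f1_def)
qed

text \<open>
  Move the rate from \<open>1\<close> to \<open>c\<close> along a segment, which stays in the right half plane. Along it, the power \<open>z\<close> of
  the rate times the integral has derivative \<open>0\<close>, by the preceding integration by parts, and at the
  rate \<open>1\<close> it is \<open>\<Gamma>(z)\<close>.
\<close>

theorem Gamma_integral_rate:
  assumes z: "0 < z" and c: "0 < Re c"
  shows "(LINT t:{0<..}|lborel. of_real (t powr (z - 1)) * exp (- (c * of_real t))) =
         of_real (Gamma z) * c powr (- of_real z)"
proof -
  \<comment> \<open>The segment of rates from \<open>1\<close> to \<open>c\<close>, and a lower bound \<open>m\<close> of their real parts.\<close>
  define r where "r x = (c - 1) * of_real x + 1" for x
  define m where "m = min 1 (Re c)"
  have m: "0 < m" using c by (simp add: m_def)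
  have r_ge: "m \<le> Re (r x)" if "x \<in> {0..1}" for x
  proof -
    have "(1 - x) * m + x * m \<le> (1 - x) * 1 + x * Re c"
      using that by (intro add_mono mult_left_mono) (auto simp: m_def)
    then show ?thesis by (simp add: r_def algebra_simps)
  qed
  have r_pos: "0 < Re (r x)" if "x \<in> {0..1}" for x using r_ge[OF that] m by simp
  define f where "f x t = indicator {0<..} t *\<^sub>R (complex_of_real (t powr (z - 1)) * exp (- (r x * of_real t)))" for x t
  define J where "J x = (LINT t:{0<..}|lborel. complex_of_real (t powr z) * exp (- (r x * of_real t)))" for x
  define I where "I x = (LINT t|lborel. f x t)" for x
  have parts: "r x * J x = of_real z * I x" if "x \<in> {0..1}" for x
    using set_integral_Gamma_parts[OF z r_pos[OF that]]
    by (simp add: J_def I_def f_def set_lebesgue_integral_def)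
  have dI: "(I has_vector_derivative (1 - c) * J x) (at x within {0..1})" if x: "x \<in> {0..1}" for x
  proof -
    define f' where "f' x t = (1 - c) * (indicator {0<..} t *\<^sub>R (complex_of_real (t powr z) * exp (- (r x * of_real t))))" for x t
    have "(I has_vector_derivative (LINT t|lborel. f' x t)) (at x within {0..1})"
      unfolding I_def
    proof (rule has_vector_derivative_lebesgue_integral[OF _ x, where
            g="\<lambda>t. norm (1 - c) * (indicator {0<..} t * (t powr z * exp (- (m * t))))"])
      show "integrable lborel (f x)" if "x \<in> {0..1}" for x
        using set_integrable_Gamma_rate[OF z r_pos[OF that]]
        unfolding f_def[abs_def] set_integrable_def by simp
      show "f' x \<in> borel_measurable lborel" unfolding f'_def[abs_def] by measurable
      show "((\<lambda>x. f x t) has_vector_derivative f' x t) (at x within {0..1})" for x t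
      proof (cases "t > 0")
        case True
        have "((\<lambda>x. exp (- (r x * of_real t))) has_vector_derivative
             (- ((c - 1) * of_real t)) * exp (- (r x * of_real t))) (at x within {0..1})"
          using has_vector_derivative_exp_affine[of "- ((c - 1) * of_real t)" "- of_real t" x "{0..1}"]
          by (simp add: r_def algebra_simps)
        moreover have "t powr z = t * t powr (z - 1)"
          using True by (simp add: powr_diff)
        ultimately show ?thesis using True
          by (auto simp: f_def f'_def algebra_simps intro!: derivative_eq_intros)
      qed (simp add: f_def f'_def)
      show "norm (f' x t) \<le> norm (1 - c) * (indicator {0<..} t * (t powr z * exp (- (m * t))))"
        if "x \<in> {0..1}" for x t
        using r_ge[OF that] by (auto simp: f'_def norm_mult mult_right_mono mult_left_mono split: split_indicator)
      have "integrable lborel (\<lambda>t. norm (indicator {0<..} t *\<^sub>R (complex_of_real (t powr (z + 1 - 1)) * exp (- (of_real m * of_real t)))))"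
        using set_integrable_Gamma_rate[of "z + 1" "of_real m"] z m unfolding set_integrable_def by (intro integrable_norm) auto
      then have "integrable lborel (\<lambda>t. indicator {0<..} t * (t powr z * exp (- (m * t))))"
        by (simp add: norm_mult)
      then show "integrable lborel (\<lambda>t. norm (1 - c) * (indicator {0<..} t * (t powr z * exp (- (m * t)))))"
        by simp
    qed auto
    then show ?thesis
      unfolding f'_def J_def set_lebesgue_integral_def integral_mult_right_zero .
  qed
  have "((\<lambda>x. r x powr of_real z * I x) has_vector_derivative 0) (at x within {0..1})" if x: "x \<in> {0..1}" for x
  proof -
    have "r x \<noteq> 0" using r_pos[OF x] by auto
    then have "r x powr of_real z = r x powr (of_real z - 1) * r x"
      by (simp add: powr_diff)
    moreover have "of_real z * r x powr (of_real z - 1) * (c - 1) * I x = r x powr (of_real z - 1) * (c - 1) * (r x * J x)"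
      using parts[OF x] by simp
    ultimately have "r x powr of_real z * ((1 - c) * J x) + of_real z * r x powr (of_real z - 1) * (c - 1) * I x = 0"
      by (simp add: algebra_simps)
    then show ?thesis
      using has_vector_derivative_mult[OF has_vector_derivative_powr_affine[of "c - 1" x 1 "of_real z" "{0..1}", folded r_def, OF r_pos[OF x]] dI[OF x]]
      by simp
  qed
  then obtain K where K: "\<And>x. x \<in> {0..1} \<Longrightarrow> r x powr of_real z * I x = K"
    using has_vector_derivative_zero_constant[of "{0..1}" "\<lambda>x. r x powr of_real z * I x"] by auto
  have "I 0 = of_real (Gamma z)"
  proof -
    have "set_integrable lebesgue {0<..} (\<lambda>t. complex_of_real t powr (of_real z - 1) / of_real (exp t))"
      using absolutely_integrable_Gamma_integral'[of "of_real z"] z by simp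
    then have "((\<lambda>t. complex_of_real t powr (of_real z - 1) / of_real (exp t)) has_integral
        (LINT t:{0<..}|lebesgue. complex_of_real t powr (of_real z - 1) / of_real (exp t))) {0<..}"
      by (rule has_integral_set_lebesgue)
    then have "(LINT t:{0<..}|lebesgue. complex_of_real t powr (of_real z - 1) / of_real (exp t)) = Gamma (of_real z)"
      by (rule has_integral_unique) (use z in \<open>auto intro!: Gamma_integral_complex'\<close>)
    also have "(LINT t:{0<..}|lebesgue. complex_of_real t powr (of_real z - 1) / of_real (exp t)) = (LINT t|lebesgue. f 0 t)"
      unfolding set_lebesgue_integral_def
    proof (intro Bochner_Integration.integral_cong refl)
      fix t :: real
      show "indicat_real {0<..} t *\<^sub>R (complex_of_real t powr (complex_of_real z - 1) / complex_of_real (exp t)) = f 0 t"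
        using powr_of_real[of t "z - 1"]
        by (auto simp: f_def r_def exp_minus field_simps exp_of_real split: split_indicator)
    qed
    also have "\<dots> = I 0"
      unfolding I_def by (rule integral_completion) (simp add: f_def)
    finally show ?thesis by (simp add: Gamma_complex_of_real)
  qed
  then have "c powr of_real z * I 1 = of_real (Gamma z)"
    using K[of 0] K[of 1] by (simp add: r_def)
  moreover have "c \<noteq> 0" using c by auto
  ultimately have "I 1 = of_real (Gamma z) * c powr (- of_real z)"
    by (simp add: powr_minus field_simps)
  then show ?thesis
    by (simp add: I_def f_def r_def set_lebesgue_integral_def)
qed

section \<open>The symbol and the transform of the right-hand side\<close>

text \<open>
  The base of the power in \<open>walk_symbol\<close>: the exponential rate that the direction \<open>\<theta>\<close> contributes to
  the Fourier-Laplace transform.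
\<close>

definition walk_rate :: "'b::euclidean_space \<Rightarrow> real \<Rightarrow> 'b \<Rightarrow> complex" where
  "walk_rate k s \<theta> = complex_of_real s - \<i> * complex_of_real (k \<bullet> \<theta>)"

lemma Re_walk_rate [simp]: "Re (walk_rate k s \<theta>) = s"
  by (simp add: walk_rate_def)

lemma walk_rate_scale: "walk_rate (y *\<^sub>R k) (y * s) \<theta> = of_real y * walk_rate k s \<theta>"
  by (simp add: walk_rate_def algebra_simps)

lemma norm_walk_rate_le:
  assumes "norm \<theta> = 1"
  shows "norm (walk_rate k s \<theta>) \<le> \<bar>s\<bar> + norm k"
proof -
  have "norm (walk_rate k s \<theta>) \<le> \<bar>s\<bar> + \<bar>k \<bullet> \<theta>\<bar>"
    unfolding walk_rate_def by (rule order_trans[OF norm_triangle_ineq4]) (simp add: norm_mult)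
  also have "\<dots> \<le> \<bar>s\<bar> + norm k"
    using Cauchy_Schwarz_ineq2[of k \<theta>] assms by simp
  finally show ?thesis .
qed

lemma walk_rate_measurable [measurable]: "walk_rate k s \<in> borel_measurable borel"
  unfolding walk_rate_def[abs_def] by measurable

lemma walk_rate_powr_measurable [measurable]:
  assumes "0 < s"
  shows "(\<lambda>\<theta>. walk_rate k s \<theta> powr of_real p) \<in> borel_measurable borel"
proof (rule borel_measurable_continuous_onI, rule continuous_on_powr_complex)
  show "continuous_on UNIV (walk_rate k s)"
    unfolding walk_rate_def[abs_def] by (intro continuous_intros)
  show "0 < Re (of_real p)" if "walk_rate k s \<theta> = 0" for \<theta>
    using assms that Re_walk_rate[of k s \<theta>] by simp
qed (use assms in auto)

locale spectral_measure = prob_space \<Lambda> for \<Lambda> :: "'b::euclidean_space measure" +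
  fixes \<beta> :: real
  assumes \<beta>: "0 < \<beta>" "\<beta> < 1"
    and sets_sphere: "sets \<Lambda> = sets (restrict_space borel (sphere 0 1))"
begin

abbreviation "\<psi> \<equiv> walk_symbol \<beta> \<Lambda>"

text \<open>
  Up to the factor \<open>\<beta>\<close> this is the derivative of \<open>\<psi>\<close> in \<open>s\<close>; it is also the transform of the
  right-hand side of the equation.
\<close>

definition \<phi> :: "'b \<Rightarrow> real \<Rightarrow> complex" where
  "\<phi> k s = (LINT \<theta>|\<Lambda>. walk_rate k s \<theta> powr of_real (\<beta> - 1))"

lemma symbol_eq: "\<psi> k s = (LINT \<theta>|\<Lambda>. walk_rate k s \<theta> powr of_real \<beta>)"
  by (simp add: walk_symbol_def walk_rate_def)

lemma norm_direction: "\<theta> \<in> space \<Lambda> \<Longrightarrow> norm \<theta> = 1"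
  using sets_eq_imp_space_eq[OF sets_sphere] by (simp add: space_restrict_space)

lemma borel_measurable_direction: "f \<in> borel_measurable borel \<Longrightarrow> f \<in> borel_measurable \<Lambda>"
  using measurable_restrict_space1[of f borel borel "sphere 0 1"] measurable_cong_sets[OF sets_sphere refl] by blast

lemma symbol_integrable: "0 < s \<Longrightarrow> integrable \<Lambda> (\<lambda>\<theta>. walk_rate k s \<theta> powr of_real \<beta>)"
proof (rule integrable_const_bound[where B="(\<bar>s\<bar> + norm k) powr \<beta>"])
  show "AE \<theta> in \<Lambda>. norm (walk_rate k s \<theta> powr of_real \<beta>) \<le> (\<bar>s\<bar> + norm k) powr \<beta>"
    using \<beta> norm_walk_rate_le[OF norm_direction, of _ k s]
    by (intro AE_I2) (auto simp: norm_powr_real_powr' intro!: powr_mono2)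
qed (intro borel_measurable_direction walk_rate_powr_measurable)

lemma symbol_zero: "0 \<le> s \<Longrightarrow> \<psi> 0 s = of_real (s powr \<beta>)"
  using powr_of_real[of s \<beta>] by (simp add: symbol_eq walk_rate_def prob_space)

lemma symbol_scale: "0 < y \<Longrightarrow> \<psi> (y *\<^sub>R k) (y * s) = of_real (y powr \<beta>) * \<psi> k s"
  by (simp add: symbol_eq walk_rate_scale powr_of_real_mult)

lemma \<phi>_scale: "0 < y \<Longrightarrow> \<phi> (y *\<^sub>R k) (y * s) = of_real (y powr (\<beta> - 1)) * \<phi> k s"
  by (simp only: \<phi>_def walk_rate_scale powr_of_real_mult integral_mult_right_zero)

lemma symbol_derivative:
  assumes "0 < s"
  shows "((\<lambda>\<sigma>. \<psi> k \<sigma>) has_vector_derivative of_real \<beta> * \<phi> k s) (at s)"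
proof -
  define f' where "f' \<sigma> \<theta> = of_real \<beta> * walk_rate k \<sigma> \<theta> powr of_real (\<beta> - 1)" for \<sigma> \<theta>
  \<comment> \<open>Staying above \<open>s/2\<close> keeps the negative power \<open>\<beta> - 1\<close> of the rate bounded.\<close>
  have "((\<lambda>\<sigma>. \<psi> k \<sigma>) has_vector_derivative (LINT \<theta>|\<Lambda>. f' s \<theta>)) (at s within {s/2<..})"
    unfolding symbol_eq
  proof (rule has_vector_derivative_lebesgue_integral[where g="\<lambda>_. \<beta> * (s/2) powr (\<beta> - 1)"])
    show "((\<lambda>\<sigma>. walk_rate k \<sigma> \<theta> powr of_real \<beta>) has_vector_derivative f' \<sigma> \<theta>) (at \<sigma> within {s/2<..})"
      if "\<sigma> \<in> {s/2<..}" for \<sigma> \<theta>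
      using has_vector_derivative_powr_affine[of 1 \<sigma> "- \<i> * of_real (k \<bullet> \<theta>)" "of_real \<beta>"] that assms
      by (simp add: walk_rate_def f'_def)
    show "norm (f' \<sigma> \<theta>) \<le> \<beta> * (s/2) powr (\<beta> - 1)" if "\<sigma> \<in> {s/2<..}" for \<sigma> \<theta>
      using norm_powr_le[of "s/2" "walk_rate k \<sigma> \<theta>" "\<beta> - 1"] that assms \<beta>
      by (simp add: f'_def norm_mult mult_left_mono)
    show "f' s \<in> borel_measurable \<Lambda>"
      unfolding f'_def[abs_def]
      by (intro borel_measurable_times borel_measurable_const borel_measurable_direction walk_rate_powr_measurable assms)
  qed (use assms symbol_integrable in auto)
  moreover have "(LINT \<theta>|\<Lambda>. f' s \<theta>) = of_real \<beta> * \<phi> k s"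
    unfolding f'_def \<phi>_def by (rule integral_mult_right_zero)
  ultimately show ?thesis
    using assms by (subst (asm) at_within_open) auto
qed

lemma direction_measurable: "(\<lambda>x. x) \<in> \<Lambda> \<rightarrow>\<^sub>M borel"
  by (rule borel_measurable_direction) simp

definition rhs_weight :: "real \<Rightarrow> real" where
  "rhs_weight t = t powr (- \<beta>) / Gamma (1 - \<beta>)"

lemma rhs_weight_nonneg: "0 \<le> rhs_weight t"
  using \<beta> Gamma_real_pos[of "1 - \<beta>"] by (simp add: rhs_weight_def)

lemma walk_rhs_eq: "walk_rhs \<beta> \<Lambda> t = density (distr \<Lambda> borel (\<lambda>\<theta>. t *\<^sub>R \<theta>)) (\<lambda>_. ennreal (rhs_weight t))"
proof -
  note direction_measurable[measurable]
  have "\<Lambda> \<bind> (\<lambda>\<theta>. return borel (t *\<^sub>R \<theta>)) = distr \<Lambda> borel (\<lambda>\<theta>. t *\<^sub>R \<theta>)"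
    by (rule bind_return_distr') (simp_all add: not_empty)
  then show ?thesis
    by (intro measure_eqI) (auto simp: walk_rhs_def rhs_weight_def emeasure_density_const)
qed

lemma integral_walk_rhs:
  fixes f :: "'b \<Rightarrow> 'c::{banach, second_countable_topology}"
  assumes [measurable]: "f \<in> borel_measurable borel"
  shows "(LINT x|walk_rhs \<beta> \<Lambda> t. f x) = rhs_weight t *\<^sub>R (LINT \<theta>|\<Lambda>. f (t *\<^sub>R \<theta>))"
proof -
  note direction_measurable[measurable]
  show ?thesis
    unfolding walk_rhs_eq using rhs_weight_nonneg
    by (subst integral_density) (auto simp: integral_distr)
qed

lemma scaled_direction_measurable [measurable]: "(\<lambda>x. fst x *\<^sub>R snd x) \<in> borel \<Otimes>\<^sub>M \<Lambda> \<rightarrow>\<^sub>M borel"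
proof -
  have [measurable]: "snd \<in> (borel :: real measure) \<Otimes>\<^sub>M \<Lambda> \<rightarrow>\<^sub>M borel"
    by (rule measurable_compose[OF measurable_snd direction_measurable])
  show ?thesis by measurable
qed

lemma walk_rhs_weakly_measurable: "weakly_measurable_family (walk_rhs \<beta> \<Lambda>)"
  unfolding weakly_measurable_family_def
proof (intro conjI allI impI)
  note direction_measurable[measurable]
  fix t :: real
  show "sets (walk_rhs \<beta> \<Lambda> t) = sets borel" by (simp add: walk_rhs_eq)
  have "emeasure (walk_rhs \<beta> \<Lambda> t) (space (walk_rhs \<beta> \<Lambda> t)) = ennreal (rhs_weight t)"
    by (simp add: walk_rhs_eq emeasure_density_const emeasure_distr emeasure_space_1)
  then show "finite_measure (walk_rhs \<beta> \<Lambda> t)" by (intro finite_measureI) simp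
next
  fix f :: "'b \<Rightarrow> real" assume "continuous_on UNIV f"
  then have f [measurable]: "f \<in> borel_measurable borel" by (rule borel_measurable_continuous_onI)
  have "(\<lambda>t. rhs_weight t *\<^sub>R (LINT \<theta>|\<Lambda>. f (t *\<^sub>R \<theta>))) \<in> borel_measurable borel"
  proof -
    have "(\<lambda>t. LINT \<theta>|\<Lambda>. f (t *\<^sub>R \<theta>)) \<in> borel_measurable borel"
      using measurable_compose[OF scaled_direction_measurable f]
      by (intro borel_measurable_lebesgue_integral) (simp add: case_prod_beta)
    then show ?thesis unfolding rhs_weight_def by measurable
  qed
  then show "(\<lambda>t. LINT x|walk_rhs \<beta> \<Lambda> t. f x) \<in> borel_measurable (restrict_space borel {0<..})"
    unfolding integral_walk_rhs[OF f] by (rule measurable_restrict_space1)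
qed

text \<open>
  After exchanging the two integrals, each direction contributes a Gamma integral whose rate is
  \<open>walk_rate k s \<theta>\<close>.
\<close>

theorem walk_rhs_transform:
  assumes s: "0 < s"
  shows "fourier_laplace_exists (walk_rhs \<beta> \<Lambda>) k s"
    and "fourier_laplace (walk_rhs \<beta> \<Lambda>) k s = \<phi> k s"
proof -
  interpret L\<Lambda>: pair_sigma_finite lborel \<Lambda> ..
  let ?f = "\<lambda>t \<theta>. indicator {0<..} t *\<^sub>R (of_real (rhs_weight t) * exp (- (walk_rate k s \<theta> * of_real t)))"
  have f_eq: "?f t \<theta> = of_real (1 / Gamma (1 - \<beta>)) *
      (indicator {0<..} t *\<^sub>R (of_real (t powr ((1 - \<beta>) - 1)) * exp (- (walk_rate k s \<theta> * of_real t))))" for t \<theta>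
    by (simp add: rhs_weight_def)
  have "0 < Gamma (1 - \<beta>)" using \<beta> by (intro Gamma_real_pos) simp
  then have G: "Gamma (1 - \<beta>) \<noteq> 0" by (rule less_imp_neq[symmetric])
  have f_meas: "(\<lambda>(t, \<theta>). ?f t \<theta>) \<in> borel_measurable (lborel \<Otimes>\<^sub>M \<Lambda>)"
  proof -
    have [measurable]: "snd \<in> (lborel :: real measure) \<Otimes>\<^sub>M \<Lambda> \<rightarrow>\<^sub>M borel"
      by (rule measurable_compose[OF measurable_snd direction_measurable])
    show ?thesis unfolding rhs_weight_def case_prod_beta by measurable
  qed
  have int: "integrable (lborel \<Otimes>\<^sub>M \<Lambda>) (\<lambda>(t, \<theta>). ?f t \<theta>)"
  proof (rule L\<Lambda>.Fubini_integrable[OF f_meas])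
    show "AE t in lborel. integrable \<Lambda> (\<lambda>\<theta>. case (t, \<theta>) of (t, \<theta>) \<Rightarrow> ?f t \<theta>)"
    proof (rule AE_I2)
      fix t :: real
      show "integrable \<Lambda> (\<lambda>\<theta>. case (t, \<theta>) of (t, \<theta>) \<Rightarrow> ?f t \<theta>)"
        using measurable_compose[OF measurable_Pair1' f_meas, of t] s rhs_weight_nonneg[of t]
        by (intro integrable_const_bound[where B="rhs_weight t"])
           (auto simp: norm_mult mult_left_le split: split_indicator intro!: AE_I2)
    qed
    have "(LINT \<theta>|\<Lambda>. norm (?f t \<theta>)) = norm (?f t 0)" for t
      by (simp add: norm_mult prob_space walk_rate_def)
    moreover have "integrable lborel (\<lambda>t. ?f t 0)"
      unfolding f_eq using set_integrable_Gamma_rate[of "1 - \<beta>" "walk_rate k s 0"] \<beta> s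
      by (intro integrable_mult_right) (simp_all add: set_integrable_def)
    ultimately show "integrable lborel (\<lambda>t. LINT \<theta>|\<Lambda>. norm (case (t, \<theta>) of (t, \<theta>) \<Rightarrow> ?f t \<theta>))"
      by (simp only: prod.case integrable_norm)
  qed
  have inner: "(LINT \<theta>|\<Lambda>. ?f t \<theta>) = indicator {0<..} t *\<^sub>R
      (of_real (exp (- s * t)) * fourier_transform (walk_rhs \<beta> \<Lambda> t) k)" for t
  proof -
    have "?f t \<theta> = (indicator {0<..} t *\<^sub>R (of_real (exp (- s * t)) * of_real (rhs_weight t))) * exp (\<i> * of_real (k \<bullet> (t *\<^sub>R \<theta>)))" for \<theta>
      by (simp add: walk_rate_def exp_of_real[symmetric] exp_add[symmetric] algebra_simps)
    then have "(LINT \<theta>|\<Lambda>. ?f t \<theta>) = (indicator {0<..} t *\<^sub>R (of_real (exp (- s * t)) * of_real (rhs_weight t))) *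
        (LINT \<theta>|\<Lambda>. exp (\<i> * of_real (k \<bullet> (t *\<^sub>R \<theta>))))"
      by (simp only: integral_mult_right_zero)
    then show ?thesis
      by (simp add: fourier_transform_def integral_walk_rhs scaleR_conv_of_real)
  qed
  show "fourier_laplace_exists (walk_rhs \<beta> \<Lambda>) k s"
    using L\<Lambda>.integrable_fst[OF int] unfolding inner fourier_laplace_exists_def set_integrable_def .
  have "fourier_laplace (walk_rhs \<beta> \<Lambda>) k s = (LINT t|lborel. LINT \<theta>|\<Lambda>. ?f t \<theta>)"
    unfolding inner fourier_laplace_def set_lebesgue_integral_def ..
  also have "\<dots> = (LINT \<theta>|\<Lambda>. LINT t|lborel. ?f t \<theta>)"
    using L\<Lambda>.Fubini_integral[OF int] by simp
  also have "\<dots> = \<phi> k s"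
    unfolding \<phi>_def
  proof (rule Bochner_Integration.integral_cong[OF refl])
    fix \<theta>
    have "(LINT t|lborel. ?f t \<theta>) = of_real (1 / Gamma (1 - \<beta>)) *
        (LINT t:{0<..}|lborel. of_real (t powr ((1 - \<beta>) - 1)) * exp (- (walk_rate k s \<theta> * of_real t)))"
      unfolding f_eq set_lebesgue_integral_def by (rule integral_mult_right_zero)
    also have "\<dots> = walk_rate k s \<theta> powr of_real (\<beta> - 1)"
      using G \<beta> s by (subst Gamma_integral_rate) auto
    finally show "(LINT t|lborel. ?f t \<theta>) = walk_rate k s \<theta> powr of_real (\<beta> - 1)" .
  qed
  finally show "fourier_laplace (walk_rhs \<beta> \<Lambda>) k s = \<phi> k s" .
qed

end

section \<open>A single increment\<close>

lemma mult_exp_neg_le: "x * exp (- (c * x)) \<le> 1 / c" if "0 < c" for c x :: real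
proof -
  have "c * x \<le> exp (c * x)" using exp_ge_add_one_self[of "c * x"] by linarith
  then show ?thesis using that by (simp add: exp_minus field_simps)
qed

text \<open>
  The law of \<open>(A(h), D(h))\<close> for a single time \<open>h\<close>, without reference to a process.
\<close>

locale stable_increment = spectral_measure \<Lambda> \<beta> + P: prob_space P
  for \<Lambda> :: "'b::euclidean_space measure" and \<beta> and P :: "'w measure" +
  fixes A :: "'w \<Rightarrow> 'b" and D :: "'w \<Rightarrow> real" and h :: real
  assumes A_meas [measurable]: "A \<in> borel_measurable P"
    and D_meas [measurable]: "D \<in> borel_measurable P"
    and D_nonneg: "\<omega> \<in> space P \<Longrightarrow> 0 \<le> D \<omega>"
    and transform: "0 \<le> s \<Longrightarrow> (LINT \<omega>|P. exp (of_real (- s * D \<omega>) + \<i> * of_real (k \<bullet> A \<omega>)))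
                                  = exp (- (of_real h * \<psi> k s))"
begin

text \<open>
  Both sides are minus the derivative in \<open>s\<close> of the transform of \<open>(A, D)\<close>.
\<close>

lemma tilted_moment:
  assumes "0 < s"
  shows "(LINT \<omega>|P. of_real (D \<omega>) * exp (of_real (- s * D \<omega>) + \<i> * of_real (k \<bullet> A \<omega>)))
          = of_real (h * \<beta>) * \<phi> k s * exp (- (of_real h * \<psi> k s))"
proof -
  let ?e = "\<lambda>\<sigma> \<omega>. exp (complex_of_real (- \<sigma> * D \<omega>) + \<i> * of_real (k \<bullet> A \<omega>))"
  \<comment> \<open>Staying above \<open>s/2\<close> keeps \<open>D e\<^bsup>-\<sigma>D\<^esup>\<close> bounded uniformly in \<open>\<sigma>\<close>.\<close>
  let ?S = "{s/2<..}"
  have at: "(at s within ?S) = at s" using assms by (intro at_within_open) auto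
  have "((\<lambda>\<sigma>. LINT \<omega>|P. ?e \<sigma> \<omega>) has_vector_derivative (LINT \<omega>|P. - of_real (D \<omega>) * ?e s \<omega>)) (at s within ?S)"
  proof (rule has_vector_derivative_lebesgue_integral[where g="\<lambda>_. 1 / (s / 2)"
        and f'="\<lambda>\<sigma> \<omega>. - of_real (D \<omega>) * ?e \<sigma> \<omega>"])
    show "integrable P (?e \<sigma>)" if "\<sigma> \<in> ?S" for \<sigma>
      using that assms D_nonneg
      by (intro P.integrable_const_bound[where B=1]) (auto simp: intro!: AE_I2)
    show "((\<lambda>\<sigma>. ?e \<sigma> \<omega>) has_vector_derivative - of_real (D \<omega>) * ?e \<sigma> \<omega>) (at \<sigma> within ?S)" for \<sigma> \<omega>
      using has_vector_derivative_exp_affine[of "- of_real (D \<omega>)" "\<i> * of_real (k \<bullet> A \<omega>)" \<sigma> ?S]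
      by (simp add: mult.commute)
    show "norm (- of_real (D \<omega>) * ?e \<sigma> \<omega>) \<le> 1 / (s / 2)" if "\<sigma> \<in> ?S" "\<omega> \<in> space P" for \<sigma> \<omega>
    proof -
      have "norm (- of_real (D \<omega>) * ?e \<sigma> \<omega>) = D \<omega> * exp (- (\<sigma> * D \<omega>))"
        using D_nonneg[OF that(2)] by (simp add: norm_mult)
      also have "\<dots> \<le> D \<omega> * exp (- (s / 2 * D \<omega>))"
        using mult_right_mono[OF less_imp_le D_nonneg[OF that(2)], of "s / 2" \<sigma>] that(1) D_nonneg[OF that(2)]
        by (intro mult_left_mono) auto
      also have "\<dots> \<le> 1 / (s / 2)" using assms by (intro mult_exp_neg_le) auto
      finally show ?thesis .
    qed
  qed (use assms in auto)
  moreover have "((\<lambda>\<sigma>. LINT \<omega>|P. ?e \<sigma> \<omega>) has_vector_derivative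
      - (of_real (h * \<beta>) * \<phi> k s * exp (- (of_real h * \<psi> k s)))) (at s within ?S)"
  proof -
    have "((\<lambda>\<sigma>. exp (- (of_real h * \<psi> k \<sigma>))) has_vector_derivative
        - (of_real (h * \<beta>) * \<phi> k s * exp (- (of_real h * \<psi> k s)))) (at s within ?S)"
    proof -
      have "((\<lambda>\<sigma>. - (of_real h * \<psi> k \<sigma>)) has_vector_derivative - (of_real h * (of_real \<beta> * \<phi> k s))) (at s within ?S)"
        unfolding at using symbol_derivative[OF assms, of k] by (auto intro!: derivative_eq_intros)
      from field_vector_diff_chain_within[OF this DERIV_subset[OF DERIV_exp]]
      show ?thesis by (simp add: o_def algebra_simps)
    qed
    then show ?thesis
      by (rule has_vector_derivative_transform[rotated 2]) (use assms transform[of _ k] in auto)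
  qed
  ultimately have "(LINT \<omega>|P. - of_real (D \<omega>) * ?e s \<omega>) =
      - (of_real (h * \<beta>) * \<phi> k s * exp (- (of_real h * \<psi> k s)))"
    unfolding at by (rule vector_derivative_unique_at)
  then show ?thesis by simp
qed

text \<open>
  Substituting \<open>v = yD\<close> turns the inner integral into
  \<open>\<integral>\<^sub>0\<^sup>1 D e\<^bsup>-y(sD - i\<langle>k,A\<rangle>)\<^esup> dy\<close>. Under the expectation the integrand becomes a tilted moment at
  \<open>(yk, ys)\<close>, and homogeneity of \<open>\<psi>\<close> and \<open>\<phi>\<close> makes it the derivative of
  \<open>- (\<phi>/\<psi>) e\<^bsup>-hy\<^sup>\<beta>\<psi>\<^esup>\<close> in \<open>y\<close>. The exchange of integrals is justified by
  \<open>\<integral>\<^sub>0\<^sup>1 D e\<^bsup>-ysD\<^esup> dy \<le> 1/s\<close>.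
\<close>

theorem excursion_moment:
  assumes s: "0 < s" and nz: "\<psi> k s \<noteq> 0"
  shows "(LINT \<omega>|P. (LINT v:{0..<D \<omega>}|lborel. exp (of_real (- s * v) + \<i> * of_real ((v / D \<omega>) * (k \<bullet> A \<omega>)))))
          = \<phi> k s * (1 - exp (- (of_real h * \<psi> k s))) / \<psi> k s"
proof -
  define f where "f \<omega> y = indicat_real {0<..<1} y *\<^sub>R
      (of_real (D \<omega>) * exp (of_real (- (y * s) * D \<omega>) + \<i> * complex_of_real ((y *\<^sub>R k) \<bullet> A \<omega>)))" for \<omega> y
  interpret pair_sigma_finite P lborel ..
  have inner: "(LINT v:{0..<D \<omega>}|lborel. exp (of_real (- s * v) + \<i> * of_real ((v / D \<omega>) * (k \<bullet> A \<omega>))))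
      = (LINT y|lborel. f \<omega> y)" if \<omega>: "\<omega> \<in> space P" for \<omega>
  proof (cases "D \<omega> = 0")
    case False
    then have d: "0 < D \<omega>" using D_nonneg[OF \<omega>] by simp
    have "(LINT v:{0..<D \<omega>}|lborel. exp (of_real (- s * v) + \<i> * of_real ((v / D \<omega>) * (k \<bullet> A \<omega>)))) =
        D \<omega> *\<^sub>R (LINT y|lborel. indicator {0..<D \<omega>} (D \<omega> * y) *\<^sub>R
          exp (of_real (- s * (D \<omega> * y)) + \<i> * of_real (y * (k \<bullet> A \<omega>))))"
      unfolding set_lebesgue_integral_def
      using d by (subst lborel_integral_real_affine[where c="D \<omega>" and t=0]) auto
    also have "\<dots> = (LINT y|lborel. D \<omega> *\<^sub>R (indicator {0..<D \<omega>} (D \<omega> * y) *\<^sub>R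
          exp (of_real (- s * (D \<omega> * y)) + \<i> * of_real (y * (k \<bullet> A \<omega>)))))"
      by (rule integral_scaleR_right[symmetric])
    also have "\<dots> = (LINT y|lborel. f \<omega> y)"
    proof (rule integral_cong_AE)
      show "AE y in lborel. D \<omega> *\<^sub>R (indicator {0..<D \<omega>} (D \<omega> * y) *\<^sub>R
          exp (of_real (- s * (D \<omega> * y)) + \<i> * of_real (y * (k \<bullet> A \<omega>)))) = f \<omega> y"
        using AE_lborel_singleton[of 0]
      proof eventually_elim
        case (elim y)
        have "indicator {0..<D \<omega>} (D \<omega> * y) = indicat_real {0<..<1} y"
          using d elim by (auto simp: indicator_def zero_le_mult_iff)
        then show ?case
          by (simp add: f_def scaleR_conv_of_real mult_ac)
      qed
    qed (auto simp: f_def[abs_def])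
    finally show ?thesis .
  qed (simp add: f_def set_lebesgue_integral_def)
  have f_meas: "(\<lambda>(\<omega>, y). f \<omega> y) \<in> borel_measurable (P \<Otimes>\<^sub>M lborel)"
    unfolding f_def by measurable
  have norm_f: "norm (f \<omega> y) \<le> indicator {0..1} y *\<^sub>R (D \<omega> * exp (- (s * D \<omega> * y)))" if "\<omega> \<in> space P" for \<omega> y
    using D_nonneg[OF that] by (auto simp: f_def norm_mult mult_ac split: split_indicator)
  have FTC: "has_bochner_integral lborel (\<lambda>y. indicator {0..1} y *\<^sub>R (D \<omega> * exp (- (s * D \<omega> * y))))
      ((1 - exp (- (s * D \<omega>))) / s)" for \<omega>
  proof -
    have "has_bochner_integral lborel (\<lambda>y. indicator {0..1} y *\<^sub>R (D \<omega> * exp (- (s * D \<omega> * y))))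
        (- exp (- (s * D \<omega> * 1)) / s - (- exp (- (s * D \<omega> * 0)) / s))"
    proof (rule has_bochner_integral_FTC_Icc)
      show "((\<lambda>y. - exp (- (s * D \<omega> * y)) / s) has_vector_derivative D \<omega> * exp (- (s * D \<omega> * y))) (at y within {0..1})" for y
        using s by (auto intro!: derivative_eq_intros simp: has_real_derivative_iff_has_vector_derivative[symmetric])
    qed (auto intro!: continuous_intros)
    then show ?thesis by (simp add: diff_divide_distrib)
  qed
  have int: "integrable (P \<Otimes>\<^sub>M lborel) (\<lambda>(\<omega>, y). f \<omega> y)"
  proof (rule Fubini_integrable[OF f_meas])
    have f_int: "integrable lborel (f \<omega>)" if "\<omega> \<in> space P" for \<omega>
      by (rule Bochner_Integration.integrable_bound[OF integrable.intros[OF FTC[of \<omega>]]])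
         (use norm_f[OF that] measurable_compose[OF measurable_Pair1'[OF that] f_meas] in \<open>auto intro!: AE_I2 order_trans[OF _ abs_ge_self]\<close>)
    then show "AE \<omega> in P. integrable lborel (\<lambda>y. case (\<omega>, y) of (\<omega>, y) \<Rightarrow> f \<omega> y)" by (auto intro!: AE_I2)
    show "integrable P (\<lambda>\<omega>. LINT y|lborel. norm (case (\<omega>, y) of (\<omega>, y) \<Rightarrow> f \<omega> y))"
    proof (rule P.integrable_const_bound[where B="1/s"])
      show "AE \<omega> in P. norm (LINT y|lborel. norm (case (\<omega>, y) of (\<omega>, y) \<Rightarrow> f \<omega> y)) \<le> 1 / s"
      proof (rule AE_I2)
        fix \<omega> assume \<omega>: "\<omega> \<in> space P"
        have "(LINT y|lborel. norm (f \<omega> y)) \<le> (LINT y|lborel. indicator {0..1} y *\<^sub>R (D \<omega> * exp (- (s * D \<omega> * y))))"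
          using f_int[OF \<omega>] norm_f[OF \<omega>] integrable.intros[OF FTC[of \<omega>]]
          by (intro integral_mono) auto
        also have "\<dots> = (1 - exp (- (s * D \<omega>))) / s"
          using FTC by (rule has_bochner_integral_integral_eq)
        also have "\<dots> \<le> 1 / s" using s by (simp add: divide_right_mono)
        finally show "norm (LINT y|lborel. norm (case (\<omega>, y) of (\<omega>, y) \<Rightarrow> f \<omega> y)) \<le> 1 / s"
          by simp
      qed
      show "(\<lambda>\<omega>. LINT y|lborel. norm (case (\<omega>, y) of (\<omega>, y) \<Rightarrow> f \<omega> y)) \<in> borel_measurable P"
        using f_meas by (intro lborel.borel_measurable_lebesgue_integral) (simp add: case_prod_beta)
    qed
  qed
  define g where "g y = of_real (h * \<beta> * y powr (\<beta> - 1)) * \<phi> k s * exp (- (of_real (h * y powr \<beta>) * \<psi> k s))" for y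
  have moment: "(LINT \<omega>|P. f \<omega> y) = indicator {0<..<1} y *\<^sub>R g y" for y
  proof (cases "y \<in> {0<..<1}")
    case True
    then have "(LINT \<omega>|P. f \<omega> y) = of_real (h * \<beta>) * \<phi> (y *\<^sub>R k) (y * s) * exp (- (of_real h * \<psi> (y *\<^sub>R k) (y * s)))"
      using tilted_moment[of "y * s" "y *\<^sub>R k"] s by (simp add: f_def)
    moreover have "0 < y" using True by simp
    ultimately show ?thesis using True by (simp add: symbol_scale \<phi>_scale g_def mult.assoc mult.left_commute)
  qed (simp add: f_def)
  have g_int: "integrable lborel (\<lambda>y. indicator {0<..<1} y *\<^sub>R g y)"
    using integrable_snd[OF int] by (simp add: moment)
  have "(LINT \<omega>|P. LINT y|lborel. f \<omega> y) = (LINT y|lborel. LINT \<omega>|P. f \<omega> y)"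
    by (rule Fubini_integral[OF int, symmetric])
  also have "\<dots> = (LBINT y=ereal 0..ereal 1. g y)"
    by (simp add: moment interval_lebesgue_integral_def set_lebesgue_integral_def)
  also have "\<dots> = - (\<phi> k s / \<psi> k s) * exp (- (of_real h * \<psi> k s)) - (- (\<phi> k s / \<psi> k s))"
  proof (rule interval_integral_FTC_integrable[where
        F="\<lambda>y. - (\<phi> k s / \<psi> k s) * exp (- (of_real (h * y powr \<beta>) * \<psi> k s))"])
    show "((\<lambda>y. - (\<phi> k s / \<psi> k s) * exp (- (of_real (h * y powr \<beta>) * \<psi> k s))) has_vector_derivative g y) (at y)"
      if "ereal 0 < ereal y" for y
    proof -
      have y: "0 < y" using that by simp
      have "((\<lambda>y. y powr \<beta>) has_vector_derivative (\<beta> * y powr (\<beta> - 1))) (at y)"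
        using has_real_derivative_powr[OF y, of \<beta>] by (simp add: has_real_derivative_iff_has_vector_derivative)
      from vector_diff_chain_at[OF this has_vector_derivative_exp_affine[of "- (of_real h * \<psi> k s)" 0]]
      have "((\<lambda>y. exp (- (of_real (h * y powr \<beta>) * \<psi> k s))) has_vector_derivative
          (\<beta> * y powr (\<beta> - 1)) *\<^sub>R (- (of_real h * \<psi> k s) * exp (- (of_real (h * y powr \<beta>) * \<psi> k s)))) (at y)"
        by (simp add: o_def mult_ac)
      from has_vector_derivative_mult_right[OF this, of "- (\<phi> k s / \<psi> k s)"] show ?thesis
        using nz by (simp add: g_def scaleR_conv_of_real mult_ac)
    qed
    show "isCont g y" if "ereal 0 < ereal y" for y
      using that unfolding g_def by (auto intro!: continuous_intros)
    show "set_integrable lborel (einterval (ereal 0) (ereal 1)) g"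
      using g_int by (simp add: set_integrable_def)
    have pw: "((\<lambda>y. y powr \<beta>) \<longlongrightarrow> 0) (at_right 0)" "((\<lambda>y. y powr \<beta>) \<longlongrightarrow> 1) (at_left 1)"
      using \<beta> by real_asymp+
    show "(((\<lambda>y. - (\<phi> k s / \<psi> k s) * exp (- (of_real (h * y powr \<beta>) * \<psi> k s))) \<circ> real_of_ereal)
        \<longlongrightarrow> - (\<phi> k s / \<psi> k s)) (at_right (ereal 0))"
      unfolding ereal_tendsto_simps by (rule tendsto_eq_intros pw refl)+ simp
    show "(((\<lambda>y. - (\<phi> k s / \<psi> k s) * exp (- (of_real (h * y powr \<beta>) * \<psi> k s))) \<circ> real_of_ereal)
        \<longlongrightarrow> - (\<phi> k s / \<psi> k s) * exp (- (of_real h * \<psi> k s))) (at_left (ereal 1))"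
      unfolding ereal_tendsto_simps by (rule tendsto_eq_intros pw refl)+ simp
  qed simp
  also have "\<dots> = \<phi> k s * (1 - exp (- (of_real h * \<psi> k s))) / \<psi> k s"
    by (simp add: right_diff_distrib diff_divide_distrib mult.commute)
  finally show ?thesis
    using inner by (simp cong: Bochner_Integration.integral_cong)
qed

end

section \<open>Passage over a level by one path\<close>

definition grid :: "nat \<Rightarrow> nat \<Rightarrow> real" where
  "grid n j = real j / 2 ^ n"

lemma grid_nonneg [simp]: "0 \<le> grid n j"
  by (simp add: grid_def)

lemma grid_0 [simp]: "grid n 0 = 0"
  by (simp add: grid_def)

lemma grid_Suc: "grid n (Suc j) = grid n j + 1 / 2 ^ n"
  by (simp add: grid_def field_simps)

text \<open>
  For an increasing clock \<open>d\<close> starting at \<open>0\<close> and \<open>t \<ge> 0\<close>, the index of the dyadic step during which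
  \<open>d\<close> passes the level \<open>t\<close>.
\<close>

definition cell :: "nat \<Rightarrow> (real \<Rightarrow> real) \<Rightarrow> real \<Rightarrow> nat" where
  "cell n d t = (LEAST j. t < d (grid n (Suc j)))"

abbreviation "lower n d t \<equiv> grid n (cell n d t)"
abbreviation "upper n d t \<equiv> grid n (Suc (cell n d t))"

text \<open>
  As a function of \<open>t\<close> this is, for an increasing clock \<open>d\<close>, the polygon with the vertices
  \<open>(d(j/2\<^sup>n), a(j/2\<^sup>n))\<close>.
\<close>

definition chord :: "nat \<Rightarrow> (real \<Rightarrow> 'b::real_vector) \<Rightarrow> (real \<Rightarrow> real) \<Rightarrow> real \<Rightarrow> 'b" where
  "chord n a d t = a (lower n d t) +
     ((t - d (lower n d t)) / (d (upper n d t) - d (lower n d t))) *\<^sub>R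
     (a (upper n d t) - a (lower n d t))"

text \<open>
  The almost sure properties of the paths of \<open>D\<close> on which the analysis of a single path rests.
\<close>

definition clock_path :: "(real \<Rightarrow> real) \<Rightarrow> bool" where
  "clock_path d \<longleftrightarrow> cadlag d \<and> d 0 = 0 \<and> strict_mono_on {0..} d \<and> (\<forall>t. \<exists>u\<ge>0. t < d u)"

text \<open>
  The filter \<open>at_right r\<close> leaves out \<open>r\<close> itself, while the sequence may hit \<open>r\<close>; this occurs when the
  passage time is a dyadic number.
\<close>

lemma tendsto_right_continuous_sequence:
  fixes f :: "real \<Rightarrow> 'b::topological_space"
  assumes f: "(f \<longlongrightarrow> f r) (at_right r)" and v: "\<And>n. r \<le> v n" "v \<longlonglongrightarrow> r"
  shows "(\<lambda>n. f (v n)) \<longlonglongrightarrow> f r"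
proof (rule topological_tendstoI)
  fix S assume S: "open S" "f r \<in> S"
  then have "eventually (\<lambda>x. f x \<in> S) (at_right r)"
    using f by (simp add: tendsto_def)
  then obtain b where b: "r < b" "\<And>y. r < y \<Longrightarrow> y < b \<Longrightarrow> f y \<in> S"
    unfolding eventually_at_right_field by blast
  have "eventually (\<lambda>n. v n < b) sequentially"
    using order_tendstoD(2)[OF v(2) b(1)] .
  then show "eventually (\<lambda>n. f (v n) \<in> S) sequentially"
  proof eventually_elim
    case (elim n)
    then show ?case using b(2)[of "v n"] S(2) v(1)[of n] by (cases "v n = r") auto
  qed
qed

lemma cadlag_left_limit:
  assumes "cadlag (x :: real \<Rightarrow> 'b::t2_space)" "0 < r"
  shows "(x \<longlongrightarrow> left_version x r) (at_left r)"
  using assms by (auto simp: cadlag_def left_version_def tendsto_Lim trivial_limit_at_left_real)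

lemma cadlag_right_limit:
  assumes "cadlag (x :: real \<Rightarrow> 'b::topological_space)" "0 \<le> r"
  shows "(x \<longlongrightarrow> x r) (at_right r)"
  using assms by (auto simp: cadlag_def)

text \<open>
  Left limits at points slightly to the right of \<open>r\<close> are limits of values that are all close to \<open>x r\<close>.
\<close>

lemma left_version_right_limit:
  fixes x :: "real \<Rightarrow> 'b::metric_space"
  assumes x: "cadlag x" and r: "0 \<le> r"
  shows "(left_version x \<longlongrightarrow> x r) (at_right r)"
proof (rule tendstoI)
  fix e :: real assume e: "0 < e"
  have "eventually (\<lambda>y. dist (x y) (x r) < e / 2) (at_right r)"
    using cadlag_right_limit[OF x r] e by (intro tendstoD) auto
  then obtain b where b: "r < b" "\<And>y. r < y \<Longrightarrow> y < b \<Longrightarrow> dist (x y) (x r) < e / 2"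
    unfolding eventually_at_right_field by blast
  have "dist (left_version x y) (x r) < e" if y: "r < y" "y < b" for y
  proof -
    have "((\<lambda>z. dist (x z) (x r)) \<longlongrightarrow> dist (left_version x y) (x r)) (at_left y)"
      using y r by (intro tendsto_intros cadlag_left_limit x) auto
    moreover have "eventually (\<lambda>z. dist (x z) (x r) \<le> e / 2) (at_left y)"
      unfolding eventually_at_left_field using y b by (intro exI[of _ r]) (auto intro: less_imp_le)
    ultimately have "dist (left_version x y) (x r) \<le> e / 2"
      by (intro tendsto_upperbound) (auto simp: trivial_limit_at_left_real)
    with e show ?thesis by simp
  qed
  then show "eventually (\<lambda>y. dist (left_version x y) (x r) < e) (at_right r)"
    unfolding eventually_at_right_field using b(1) by blast
qed

locale clock =
  fixes d :: "real \<Rightarrow> real"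
  assumes clock_path: "clock_path d"
begin

abbreviation "E \<equiv> passage_time d"

lemma d_cadlag: "cadlag d" and d_0: "d 0 = 0" and d_unbounded: "\<exists>u\<ge>0. t < d u"
  using clock_path by (auto simp: clock_path_def)

lemma d_less: "0 \<le> x \<Longrightarrow> x < y \<Longrightarrow> d x < d y"
  using clock_path by (auto simp: clock_path_def strict_mono_on_def)

lemma d_le: "0 \<le> x \<Longrightarrow> x \<le> y \<Longrightarrow> d x \<le> d y"
  using d_less[of x y] by (cases "x = y") auto

lemma passage_le: "0 \<le> r \<Longrightarrow> t < d r \<Longrightarrow> E t \<le> r"
  unfolding passage_time_def by (intro cInf_lower) (auto intro: bdd_belowI[of _ 0])

lemma passage_nonneg: "0 \<le> E t"
  unfolding passage_time_def using d_unbounded[of t] by (intro cInf_greatest) auto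

lemma before_passage: "0 \<le> r \<Longrightarrow> r < E t \<Longrightarrow> d r \<le> t"
  using passage_le[of r t] by linarith

lemma after_passage:
  assumes "E t < r" shows "t < d r"
proof -
  obtain r' where r': "0 \<le> r'" "t < d r'" "r' < r"
    using assms d_unbounded[of t] unfolding passage_time_def
    by (subst (asm) cInf_less_iff) (auto intro: bdd_belowI[of _ 0])
  then show ?thesis using d_less[of r' r] by simp
qed

lemma passage_overshoots: "t \<le> d (E t)"
proof (rule tendsto_lowerbound)
  show "(d \<longlongrightarrow> d (E t)) (at_right (E t))"
    by (rule cadlag_right_limit[OF d_cadlag passage_nonneg])
  show "eventually (\<lambda>r. t \<le> d r) (at_right (E t))"
    using eventually_at_right_less by eventually_elim (auto dest: after_passage)
qed (simp add: trivial_limit_at_right_real)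

lemma cell_exists: "\<exists>j. t < d (grid n (Suc j))"
proof -
  obtain u where u: "0 \<le> u" "t < d u" using d_unbounded by blast
  obtain j where "u * 2 ^ n \<le> real j" using real_arch_simple by blast
  then have "u \<le> grid n (Suc j)" by (simp add: grid_def field_simps)
  then show ?thesis using d_le[OF u(1)] u(2) by (intro exI[of _ j]) (metis order_less_le_trans)
qed

lemma upper_exceeds: "t < d (upper n d t)"
  unfolding cell_def by (rule LeastI_ex[OF cell_exists])

lemma lower_le:
  assumes "0 \<le> t" shows "d (lower n d t) \<le> t"
proof (cases "cell n d t")
  case 0
  then show ?thesis using assms d_0 by simp
next
  case (Suc j)
  then have "j < cell n d t" by simp
  then have "\<not> t < d (grid n (Suc j))" unfolding cell_def by (rule not_less_Least)
  then show ?thesis using Suc by simp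
qed

lemma cell_eq_iff:
  assumes "0 \<le> t"
  shows "cell n d t = j \<longleftrightarrow> d (grid n j) \<le> t \<and> t < d (grid n (Suc j))"
proof
  show "cell n d t = j \<Longrightarrow> d (grid n j) \<le> t \<and> t < d (grid n (Suc j))"
    using lower_le[OF assms] upper_exceeds by blast
  assume j: "d (grid n j) \<le> t \<and> t < d (grid n (Suc j))"
  have mono: "d (grid n i) \<le> d (grid n k)" if "i \<le> k" for i k
    using that by (intro d_le) (auto simp: grid_def divide_right_mono)
  show "cell n d t = j"
    unfolding cell_def
  proof (rule Least_equality)
    show "j \<le> i" if "t < d (grid n (Suc i))" for i
      using mono[of "Suc i" j] that j by (meson not_less_eq_eq leD order_trans)
  qed (use j in simp)
qed

lemma passage_le_upper: "E t \<le> upper n d t"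
  by (rule passage_le[OF grid_nonneg upper_exceeds])

lemma lower_le_passage: "0 \<le> t \<Longrightarrow> lower n d t \<le> E t"
  using after_passage[of t "lower n d t"] lower_le[of t n] by force

lemma upper_tendsto: 
  assumes "0 \<le> t" shows "(\<lambda>n. upper n d t) \<longlonglongrightarrow> E t"
proof (rule tendsto_sandwich[of "\<lambda>_. E t" _ _ "\<lambda>n. E t + 1 / 2 ^ n"])
  have "upper n d t \<le> E t + 1 / 2 ^ n" for n
    using lower_le_passage[OF assms, of n] by (simp add: grid_Suc)
  then show "\<forall>\<^sub>F n in sequentially. upper n d t \<le> E t + 1 / 2 ^ n" by simp
  show "(\<lambda>n. E t + 1 / 2 ^ n) \<longlonglongrightarrow> E t"
    using tendsto_add[OF tendsto_const[of "E t"] LIMSEQ_divide_realpow_zero[of 2 1]] by simp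
qed (simp_all add: passage_le_upper)

lemma lower_tendsto: 
  assumes "0 \<le> t" shows "(\<lambda>n. lower n d t) \<longlonglongrightarrow> E t"
proof -
  have "(\<lambda>n. upper n d t - 1 / 2 ^ n) \<longlonglongrightarrow> E t - 0"
    by (intro tendsto_diff upper_tendsto[OF assms] LIMSEQ_divide_realpow_zero) simp
  then show ?thesis by (simp add: grid_Suc)
qed

lemma upper_value_tendsto:
  assumes "cadlag (a :: real \<Rightarrow> 'b::topological_space)" "0 \<le> t"
  shows "(\<lambda>n. a (upper n d t)) \<longlonglongrightarrow> a (E t)"
  by (rule tendsto_right_continuous_sequence[OF cadlag_right_limit[OF assms(1) passage_nonneg]
        passage_le_upper upper_tendsto[OF assms(2)]])

text \<open>
  If the clock reaches the level \<open>t\<close> exactly, right-continuity keeps it below any \<open>s > t\<close> for a while after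
  \<open>E t\<close>, so \<open>E\<close> is strictly larger than \<open>E t\<close> to the right of \<open>t\<close>.
\<close>

lemma passage_tendsto:
  assumes "d (E t) = t"
  shows "filterlim E (at_right (E t)) (at_right t)"
proof (rule tendsto_imp_filterlim_at_right)
  have gt: "E t < E s" if "t < s" for s
  proof -
    have "eventually (\<lambda>r. d r < s) (at_right (E t))"
      using order_tendstoD(2)[OF cadlag_right_limit[OF d_cadlag passage_nonneg[of t]]] that assms by simp
    then have "eventually (\<lambda>r. d r < s \<and> E t < r) (at_right (E t))"
      using eventually_at_right_less by eventually_elim simp
    then obtain r where "d r < s" "E t < r"
      using eventually_happens trivial_limit_at_right_real by blast
    then have "\<not> E s < r" using after_passage[of s r] by auto
    with \<open>E t < r\<close> show ?thesis by simp
  qed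
  then show "eventually (\<lambda>s. E t < E s) (at_right t)"
    using eventually_at_right_less[of t] by (rule eventually_mono[rotated])
  show "(E \<longlongrightarrow> E t) (at_right t)"
  proof (rule order_tendstoI)
    show "eventually (\<lambda>s. y < E s) (at_right t)" if "y < E t" for y
      using eventually_at_right_less[of t] by eventually_elim (use gt that in force)
    fix y assume "E t < y"
    then have r: "E t < (E t + y) / 2" "(E t + y) / 2 < y" "0 \<le> (E t + y) / 2" using passage_nonneg[of t] by auto
    then have "t < d ((E t + y) / 2)" by (intro after_passage)
    then have "eventually (\<lambda>s. s < d ((E t + y) / 2)) (at_right t)"
      by (auto simp: eventually_at_right_field)
    then show "eventually (\<lambda>s. E s < y) (at_right t)"
      by eventually_elim (use passage_le[OF r(3)] r(2) in force)
  qed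
qed

lemma pre_passage_continuous:
  fixes a :: "real \<Rightarrow> 'b::metric_space"
  assumes "cadlag a" "d (E t) = t"
  shows "pre_passage a d t = a (E t)"
  unfolding pre_passage_def
  by (intro tendsto_Lim filterlim_compose[OF left_version_right_limit[OF assms(1) passage_nonneg] passage_tendsto] assms)
     (simp add: trivial_limit_at_right_real)

text \<open>
  While the level stays inside the jump, the passage time does not change.
\<close>

lemma pre_passage_jump:
  fixes a :: "real \<Rightarrow> 'b::t2_space"
  assumes "t < d (E t)"
  shows "pre_passage a d t = left_version a (E t)"
  unfolding pre_passage_def
proof (intro tendsto_Lim tendsto_eventually)
  have "E s = E t" if "t < s" "s < d (E t)" for s
  proof (rule antisym)
    show "E s \<le> E t" using that by (intro passage_le passage_nonneg)
    show "E t \<le> E s"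
      using that passage_overshoots[of s] by (intro passage_le passage_nonneg) simp
  qed
  then show "eventually (\<lambda>s. left_version a (E s) = left_version a (E t)) (at_right t)"
    unfolding eventually_at_right_field using assms by (intro exI[of _ "d (E t)"]) auto
qed (simp add: trivial_limit_at_right_real)

lemma passage_pos:
  assumes "0 \<le> t" "t < d (E t)"
  shows "0 < E t"
  using assms d_0 passage_nonneg[of t] by (cases "E t = 0") auto

text \<open>
  Before \<open>E t\<close> the clock stays at or below \<open>t\<close>. If it took the value \<open>t\<close> there, strict monotonicity would
  push it above \<open>t\<close> still before \<open>E t\<close>.
\<close>

lemma not_in_range:
  assumes "t < d (E t)" shows "t \<notin> d ` {0..}"
proof
  assume "t \<in> d ` {0..}"
  then obtain r where r: "0 \<le> r" "d r = t" by auto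
  have "r < E t" using d_le[OF passage_nonneg, of t r] r assms by force
  then have "d ((r + E t) / 2) \<le> t" "d r < d ((r + E t) / 2)"
    using r by (auto intro!: before_passage d_less)
  then show False using r by simp
qed

lemma left_value_tendsto:
  assumes a: "cadlag (a :: real \<Rightarrow> 'b::t2_space)" and t: "0 \<le> t" "t < d (E t)"
  shows "(\<lambda>n. a (lower n d t)) \<longlonglongrightarrow> left_version a (E t)"
proof (rule filterlim_compose[OF cadlag_left_limit[OF a passage_pos[OF t]]])
  have "lower n d t < E t" for n
    using lower_le_passage[OF t(1), of n] lower_le[OF t(1), of n] t(2) by (cases "lower n d t = E t") auto
  then show "filterlim (\<lambda>n. lower n d t) (at_left (E t)) sequentially"
    by (intro tendsto_imp_filterlim_at_left lower_tendsto t) auto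
qed

text \<open>
  On the range \<open>L(t) = X(t)\<close>, and \<open>X(t) = A(E(t))\<close> since the passage times approach \<open>E(t)\<close> strictly
  from the right.
\<close>

theorem levy_walk_on_range:
  fixes a :: "real \<Rightarrow> 'b::real_normed_vector"
  assumes a: "cadlag a" and t: "0 \<le> t" and range: "d (E t) = t"
  shows "(\<lambda>n. a (upper n d t)) \<longlonglongrightarrow> levy_walk a d t"
proof -
  have "t \<in> d ` {0..}" using range passage_nonneg[of t] by (metis atLeast_iff image_eqI)
  then have "levy_walk a d t = a (E t)"
    by (simp add: levy_walk_def pre_passage_continuous[OF a range])
  then show ?thesis using upper_value_tendsto[OF a t] by simp
qed

text \<open>
  Since \<open>lower n d t < E t \<le> upper n d t\<close>, the chord ends converge to the values at both sides of the
  jump at \<open>E t\<close>. The limit of the denominators is the size of the jump and does not vanish.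
\<close>

theorem levy_walk_off_range:
  fixes a :: "real \<Rightarrow> 'b::real_normed_vector"
  assumes a: "cadlag a" and t: "0 \<le> t" and off: "d (E t) \<noteq> t"
  shows "(\<lambda>n. chord n a d t) \<longlonglongrightarrow> levy_walk a d t"
proof -
  have jump: "t < d (E t)" using off passage_overshoots[of t] by simp
  have "left_version d (E t) \<le> t"
    by (rule LIMSEQ_le_const2[OF left_value_tendsto[OF d_cadlag t jump]]) (use lower_le[OF t] in auto)
  then have ne: "d (E t) - left_version d (E t) \<noteq> 0" using jump by simp
  have "levy_walk a d t = left_version a (E t) +
      ((t - left_version d (E t)) / (d (E t) - left_version d (E t))) *\<^sub>R (a (E t) - left_version a (E t))"
    using not_in_range[OF jump]
    by (simp add: levy_walk_def Let_def pre_passage_jump[OF jump] post_passage_def)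
  moreover have "(\<lambda>n. chord n a d t) \<longlonglongrightarrow> left_version a (E t) +
      ((t - left_version d (E t)) / (d (E t) - left_version d (E t))) *\<^sub>R (a (E t) - left_version a (E t))"
    unfolding chord_def
    by (intro tendsto_intros left_value_tendsto upper_value_tendsto a d_cadlag t jump ne)
  ultimately show ?thesis by simp
qed

end

section \<open>The dyadic skeleton and its renewal structure\<close>

lemma set_integrable_exp_neg:
  fixes s :: real
  assumes "0 < s"
  shows "integrable lborel (\<lambda>t. indicator {0..} t * exp (- (s * t)))"
proof -
  have "integrable lborel (\<lambda>t. norm (indicator {0<..} t *\<^sub>R (complex_of_real (t powr (1 - 1)) * exp (- (of_real s * of_real t)))))"
    using set_integrable_Gamma_rate[of 1 "of_real s"] assms unfolding set_integrable_def by (intro integrable_norm) auto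
  then show ?thesis
    by (rule integrable_cong_AE_imp) (use AE_lborel_singleton[of 0] in \<open>auto elim!: eventually_mono simp: indicator_def\<close>)
qed

lemma integral_exp_neg_bound:
  fixes s :: real
  assumes "0 < s"
  shows "(LINT t|lborel. indicator {0..} t * exp (- (s * t))) = 1 / s"
proof -
  have "complex_of_real (LINT t|lborel. indicator {0..} t * exp (- (s * t))) =
      (LINT t:{0<..}|lborel. complex_of_real (t powr (1 - 1)) * exp (- (of_real s * of_real t)))"
    unfolding set_lebesgue_integral_def integral_complex_of_real[symmetric]
    by (rule integral_cong_AE)
       (use AE_lborel_singleton[of 0] in \<open>auto elim!: eventually_mono simp: indicator_def exp_of_real[symmetric]\<close>)
  also have "\<dots> = complex_of_real (1 / s)"
    using Gamma_integral_rate[of 1 "of_real s"] assms by (simp add: powr_minus field_simps)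
  finally show ?thesis using of_real_eq_iff by blast
qed

text \<open>
  The contribution of one dyadic step with increment \<open>z\<close>, on the time axis shifted to the start of the step.
\<close>

definition excursion :: "(real \<times> 'b::euclidean_space \<times> real \<Rightarrow> complex) \<Rightarrow> 'b \<times> real \<Rightarrow> complex" where
  "excursion F z = (LINT v:{0..<snd z}|lborel. F (v, z))"

text \<open>
  All paths are regular here, not just almost all. The assumption \<open>factor\<close> condenses the independence
  and stationarity of the increments and the transform of \<open>(A(u), D(u))\<close> into one identity, which
  survives a modification of the paths on a null set.
\<close>

locale regular_walk = spectral_measure \<Lambda> \<beta> + P: prob_space M
  for \<Lambda> :: "'b::euclidean_space measure" and \<beta> and M :: "'w measure" +
  fixes A :: "real \<Rightarrow> 'w \<Rightarrow> 'b" and D :: "real \<Rightarrow> 'w \<Rightarrow> real"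
  assumes A_meas: "0 \<le> t \<Longrightarrow> A t \<in> borel_measurable M"
    and D_meas: "0 \<le> t \<Longrightarrow> D t \<in> borel_measurable M"
    and A_cadlag: "\<omega> \<in> space M \<Longrightarrow> cadlag (\<lambda>t. A t \<omega>)"
    and D_clock: "\<omega> \<in> space M \<Longrightarrow> clock_path (\<lambda>t. D t \<omega>)"
    and factor: "\<lbrakk>0 \<le> u; 0 \<le> h; 0 \<le> s; g \<in> borel_measurable borel; \<And>z. norm (g z) \<le> B\<rbrakk> \<Longrightarrow>
      (LINT \<omega>|M. exp (of_real (- s * D u \<omega>) + \<i> * of_real (k \<bullet> A u \<omega>)) *
                   g (A (u + h) \<omega> - A u \<omega>, D (u + h) \<omega> - D u \<omega>)) =
      exp (- (of_real u * \<psi> k s)) * (LINT \<omega>|M. g (A h \<omega>, D h \<omega>) :: complex)"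
begin

sublocale TM: pair_sigma_finite lborel M ..

lemma clock: "\<omega> \<in> space M \<Longrightarrow> clock (\<lambda>t. D t \<omega>)"
  using D_clock by (simp add: clock_def)

lemma D_nonneg: "\<omega> \<in> space M \<Longrightarrow> 0 \<le> t \<Longrightarrow> 0 \<le> D t \<omega>"
  using clock.d_le[OF clock, of \<omega> 0 t] clock.d_0[OF clock, of \<omega>] by simp

lemma transform:
  assumes "0 \<le> h" "0 \<le> s"
  shows "(LINT \<omega>|M. exp (of_real (- s * D h \<omega>) + \<i> * of_real (k \<bullet> A h \<omega>))) = exp (- (of_real h * \<psi> k s))"
  using factor[of h 0 s "\<lambda>_. 1" 1 k] assms P.prob_space by simp

lemma increment: "0 \<le> h \<Longrightarrow> stable_increment \<Lambda> \<beta> M (A h) (D h) h"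
  by unfold_locales (use A_meas D_meas D_nonneg transform in auto)

lemma laplace_D:
  assumes "0 \<le> h" "0 \<le> s"
  shows "(LINT \<omega>|M. exp (- (s * D h \<omega>))) = exp (- (h * s powr \<beta>))"
proof -
  have "complex_of_real (LINT \<omega>|M. exp (- (s * D h \<omega>))) = of_real (exp (- (h * s powr \<beta>)))"
    using transform[OF assms, of 0] assms(2)
    by (simp add: symbol_zero integral_complex_of_real[symmetric] exp_of_real[symmetric])
  then show ?thesis using of_real_eq_iff by blast
qed

lemma norm_transform_less_1:
  assumes "0 < h" "0 < s"
  shows "norm (exp (- (of_real h * \<psi> k s))) < 1"
proof -
  have "norm (exp (- (of_real h * \<psi> k s))) \<le> (LINT \<omega>|M. norm (exp (of_real (- s * D h \<omega>) + \<i> * of_real (k \<bullet> A h \<omega>))))"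
    using integral_norm_bound[of M "\<lambda>\<omega>. exp (of_real (- s * D h \<omega>) + \<i> * of_real (k \<bullet> A h \<omega>))"]
      transform[of h s k] assms by simp
  also have "\<dots> = exp (- (h * s powr \<beta>))"
    using laplace_D[of h s] assms by simp
  also have "\<dots> < 1" using assms by simp
  finally show ?thesis .
qed

lemma symbol_nonzero: "0 < s \<Longrightarrow> \<psi> k s \<noteq> 0"
  using norm_transform_less_1[of 1 s k] by auto

abbreviation "J n t \<omega> \<equiv> cell n (\<lambda>r. D r \<omega>) t"

lemma cell_measurable [measurable]:
  "(\<lambda>(t, \<omega>). J n t \<omega>) \<in> lborel \<Otimes>\<^sub>M M \<rightarrow>\<^sub>M count_space UNIV"
proof -
  note D_meas[OF grid_nonneg, measurable]
  show ?thesis unfolding cell_def case_prod_beta by measurable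
qed

lemma grid_values_measurable [measurable]:
  "(\<lambda>(t, \<omega>). D (grid n (J n t \<omega>)) \<omega>) \<in> borel_measurable (lborel \<Otimes>\<^sub>M M)"
  "(\<lambda>(t, \<omega>). D (grid n (Suc (J n t \<omega>))) \<omega>) \<in> borel_measurable (lborel \<Otimes>\<^sub>M M)"
  "(\<lambda>(t, \<omega>). A (grid n (J n t \<omega>)) \<omega>) \<in> borel_measurable (lborel \<Otimes>\<^sub>M M)"
  "(\<lambda>(t, \<omega>). A (grid n (Suc (J n t \<omega>))) \<omega>) \<in> borel_measurable (lborel \<Otimes>\<^sub>M M)"
proof -
  note D_meas[OF grid_nonneg, measurable] A_meas[OF grid_nonneg, measurable]
  note J = cell_measurable[of n, unfolded case_prod_beta]
  show "(\<lambda>(t, \<omega>). D (grid n (J n t \<omega>)) \<omega>) \<in> borel_measurable (lborel \<Otimes>\<^sub>M M)"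
    unfolding case_prod_beta
    by (rule measurable_compose_countable[where f="\<lambda>j x. D (grid n j) (snd x)", OF _ J]) measurable
  show "(\<lambda>(t, \<omega>). D (grid n (Suc (J n t \<omega>))) \<omega>) \<in> borel_measurable (lborel \<Otimes>\<^sub>M M)"
    unfolding case_prod_beta
    by (rule measurable_compose_countable[where f="\<lambda>j x. D (grid n (Suc j)) (snd x)", OF _ J]) measurable
  show "(\<lambda>(t, \<omega>). A (grid n (J n t \<omega>)) \<omega>) \<in> borel_measurable (lborel \<Otimes>\<^sub>M M)"
    unfolding case_prod_beta
    by (rule measurable_compose_countable[where f="\<lambda>j x. A (grid n j) (snd x)", OF _ J]) measurable
  show "(\<lambda>(t, \<omega>). A (grid n (Suc (J n t \<omega>))) \<omega>) \<in> borel_measurable (lborel \<Otimes>\<^sub>M M)"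
    unfolding case_prod_beta
    by (rule measurable_compose_countable[where f="\<lambda>j x. A (grid n (Suc j)) (snd x)", OF _ J]) measurable
qed

lemma exp_neg_integrable_pair:
  fixes s :: real
  assumes "0 < s"
  shows "integrable (lborel \<Otimes>\<^sub>M M) (\<lambda>(t, \<omega>). indicator {0..} t * exp (- (s * t)))"
  by (rule TM.Fubini_integrable)
     (use set_integrable_exp_neg[OF assms] P.prob_space in \<open>auto simp: abs_mult\<close>)

text \<open>
  At time \<open>t\<close>, the exponential at the start of the current dyadic step times a functional \<open>F\<close> of the
  time elapsed since then and of the increment over the step. The exponential of the polygon and the
  damped overshoot are both of this form.
\<close>

definition skeleton_functional :: "nat \<Rightarrow> 'b \<Rightarrow> real \<Rightarrow> (real \<times> 'b \<times> real \<Rightarrow> complex) \<Rightarrow> real \<Rightarrow> 'w \<Rightarrow> complex" where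
  "skeleton_functional n k s F t \<omega> =
     (let u = grid n (J n t \<omega>); v = grid n (Suc (J n t \<omega>)) in
      indicator {0..} t *\<^sub>R (exp (of_real (- s * D u \<omega>) + \<i> * of_real (k \<bullet> A u \<omega>)) *
        F (t - D u \<omega>, A v \<omega> - A u \<omega>, D v \<omega> - D u \<omega>)))"

context
  fixes F :: "real \<times> 'b \<times> real \<Rightarrow> complex" and s :: real
  assumes s: "0 < s" and F_meas [measurable]: "F \<in> borel_measurable borel"
    and F_bound: "\<And>v z. 0 \<le> v \<Longrightarrow> norm (F (v, z)) \<le> exp (- (s * v))"
begin

lemma skeleton_functional_measurable [measurable]:
  "(\<lambda>(t, \<omega>). skeleton_functional n k s F t \<omega>) \<in> borel_measurable (lborel \<Otimes>\<^sub>M M)"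
  unfolding skeleton_functional_def Let_def by measurable

lemma skeleton_functional_bound:
  assumes "\<omega> \<in> space M"
  shows "norm (skeleton_functional n k s F t \<omega>) \<le> indicator {0..} t * exp (- (s * t))"
proof (cases "0 \<le> t")
  case True
  let ?u = "grid n (J n t \<omega>)"
  have "norm (skeleton_functional n k s F t \<omega>) \<le> exp (- (s * D ?u \<omega>)) * exp (- (s * (t - D ?u \<omega>)))"
    using True clock.lower_le[OF clock[OF assms] True]
    by (auto simp: skeleton_functional_def Let_def norm_mult intro!: mult_left_mono F_bound)
  also have "\<dots> = exp (- (s * t))" by (simp add: exp_add[symmetric] algebra_simps)
  finally show ?thesis using True by simp
qed (simp add: skeleton_functional_def)

lemma skeleton_functional_integrable:
  "integrable (lborel \<Otimes>\<^sub>M M) (\<lambda>(t, \<omega>). skeleton_functional n k s F t \<omega>)"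
  by (rule Bochner_Integration.integrable_bound[OF exp_neg_integrable_pair[OF s]])
     (use skeleton_functional_bound in \<open>auto intro!: AE_I2 order_trans[OF _ abs_ge_self] simp: space_pair_measure\<close>)

lemma excursion_measurable [measurable]: "excursion F \<in> borel_measurable borel"
proof -
  have [measurable]: "(snd :: 'b \<times> real \<Rightarrow> real) \<in> borel_measurable borel"
    by (intro borel_measurable_continuous_onI continuous_intros)
  have [measurable]: "(\<lambda>x. F (snd x, fst x)) \<in> borel_measurable ((borel :: ('b \<times> real) measure) \<Otimes>\<^sub>M lborel)"
    by (rule measurable_compose[OF _ F_meas]) measurable
  have "(\<lambda>z. LINT v|lborel. (if 0 \<le> v \<and> v < snd z then F (v, z) else 0)) \<in> borel_measurable (borel :: ('b \<times> real) measure)"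
    by (rule lborel.borel_measurable_lebesgue_integral) measurable
  also have "(\<lambda>z. LINT v|lborel. (if 0 \<le> v \<and> v < snd z then F (v, z) else 0)) = excursion F"
    unfolding excursion_def[abs_def] set_lebesgue_integral_def
    by (intro ext Bochner_Integration.integral_cong) auto
  finally show ?thesis .
qed

lemma excursion_bound: "norm (excursion F z) \<le> 1 / s"
proof -
  have le: "norm (indicator {0..<snd z} v *\<^sub>R F (v, z)) \<le> indicator {0..} v * exp (- (s * v))" for v
    using F_bound[of v z] by (auto split: split_indicator)
  have "integrable lborel (\<lambda>v. indicator {0..<snd z} v *\<^sub>R F (v, z))"
    by (rule Bochner_Integration.integrable_bound[OF set_integrable_exp_neg[OF s]])
       (use le in \<open>auto intro!: AE_I2 order_trans[OF _ abs_ge_self]\<close>)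
  then have "norm (excursion F z) \<le> (LINT v|lborel. indicator {0..} v * exp (- (s * v)))"
    unfolding excursion_def set_lebesgue_integral_def
    by (rule Bochner_Integration.integral_norm_bound_integral[OF _ set_integrable_exp_neg[OF s] le])
  then show ?thesis by (simp add: integral_exp_neg_bound s)
qed

text \<open>
  For fixed \<open>\<omega>\<close>, step \<open>j\<close> is current on an interval of times; shifted to start at \<open>0\<close>, it yields the
  excursion integral of the increment, to which \<open>factor\<close> applies.
\<close>

lemma cell_integral:
  "(LINT x:{x. 0 \<le> fst x \<and> J n (fst x) (snd x) = j} \<inter> space (lborel \<Otimes>\<^sub>M M)|(lborel \<Otimes>\<^sub>M M).
      skeleton_functional n k s F (fst x) (snd x)) =
   exp (- (of_real (1 / 2 ^ n) * \<psi> k s)) ^ j * (LINT \<omega>|M. excursion F (A (1 / 2 ^ n) \<omega>, D (1 / 2 ^ n) \<omega>))"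
proof -
  let ?u = "grid n j" and ?v = "grid n (Suc j)"
  let ?B = "{x. 0 \<le> fst x \<and> J n (fst x) (snd x) = j} \<inter> space (lborel \<Otimes>\<^sub>M M)"
  let ?g = "\<lambda>t \<omega>. indicator {D ?u \<omega>..<D ?v \<omega>} t *\<^sub>R (exp (of_real (- s * D ?u \<omega>) + \<i> * of_real (k \<bullet> A ?u \<omega>)) *
        F (t - D ?u \<omega>, A ?v \<omega> - A ?u \<omega>, D ?v \<omega> - D ?u \<omega>))"
  have B: "?B \<in> sets (lborel \<Otimes>\<^sub>M M)"
  proof -
    have "{x \<in> space (lborel \<Otimes>\<^sub>M M). 0 \<le> fst x \<and> (\<lambda>(t, \<omega>). J n t \<omega>) x = j} \<in> sets (lborel \<Otimes>\<^sub>M M)"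
      by measurable
    then show ?thesis by (simp add: case_prod_beta Int_def conj_commute)
  qed
  have eq: "indicator ?B x *\<^sub>R skeleton_functional n k s F (fst x) (snd x) = ?g (fst x) (snd x)"
    if x: "x \<in> space (lborel \<Otimes>\<^sub>M M)" for x
  proof -
    have \<omega>: "snd x \<in> space M" using x by (auto simp: space_pair_measure)
    have "x \<in> ?B \<longleftrightarrow> fst x \<in> {D ?u (snd x)..<D ?v (snd x)}"
    proof (cases "0 \<le> fst x")
      case True
      then show ?thesis using clock.cell_eq_iff[OF clock[OF \<omega>] True, of n j] x by auto
    next
      case False
      then show ?thesis using D_nonneg[OF \<omega>, of ?u] by auto
    qed
    then show ?thesis
      by (auto simp: skeleton_functional_def Let_def indicator_def)
  qed
  have int: "integrable (lborel \<Otimes>\<^sub>M M) (\<lambda>(t, \<omega>). ?g t \<omega>)"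
  proof -
    have "integrable (lborel \<Otimes>\<^sub>M M) (\<lambda>x. indicator ?B x *\<^sub>R skeleton_functional n k s F (fst x) (snd x))"
      using integrable_mult_indicator[OF B skeleton_functional_integrable[of n k]] by (simp add: case_prod_beta)
    moreover have "integrable (lborel \<Otimes>\<^sub>M M) (\<lambda>x. indicator ?B x *\<^sub>R skeleton_functional n k s F (fst x) (snd x)) \<longleftrightarrow>
        integrable (lborel \<Otimes>\<^sub>M M) (\<lambda>x. ?g (fst x) (snd x))"
      by (rule Bochner_Integration.integrable_cong[OF refl eq])
    ultimately show ?thesis unfolding case_prod_beta by (rule iffD1[rotated])
  qed
  have "(LINT x:?B|(lborel \<Otimes>\<^sub>M M). skeleton_functional n k s F (fst x) (snd x)) = (LINT x|(lborel \<Otimes>\<^sub>M M). ?g (fst x) (snd x))"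
    unfolding set_lebesgue_integral_def by (rule Bochner_Integration.integral_cong[OF refl eq])
  also have "\<dots> = (LINT \<omega>|M. (LINT t|lborel. ?g t \<omega>))"
    using TM.integral_snd[OF int, symmetric] unfolding case_prod_beta .
  also have "\<dots> = (LINT \<omega>|M. exp (of_real (- s * D ?u \<omega>) + \<i> * of_real (k \<bullet> A ?u \<omega>)) *
                   excursion F (A (?u + 1 / 2 ^ n) \<omega> - A ?u \<omega>, D (?u + 1 / 2 ^ n) \<omega> - D ?u \<omega>))"
  proof (rule Bochner_Integration.integral_cong[OF refl])
    fix \<omega> assume "\<omega> \<in> space M"
    have "(LINT t|lborel. ?g t \<omega>) = (LINT v|lborel. ?g (D ?u \<omega> + v) \<omega>)"
      using lborel_integral_real_affine[of 1 "\<lambda>t. ?g t \<omega>" "D ?u \<omega>"] by simp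
    also have "\<dots> = (LINT v|lborel. exp (of_real (- s * D ?u \<omega>) + \<i> * of_real (k \<bullet> A ?u \<omega>)) *
        (indicator {0..<D ?v \<omega> - D ?u \<omega>} v *\<^sub>R F (v, A ?v \<omega> - A ?u \<omega>, D ?v \<omega> - D ?u \<omega>)))"
      by (rule Bochner_Integration.integral_cong[OF refl]) (auto simp: indicator_def)
    also have "\<dots> = exp (of_real (- s * D ?u \<omega>) + \<i> * of_real (k \<bullet> A ?u \<omega>)) *
        excursion F (A ?v \<omega> - A ?u \<omega>, D ?v \<omega> - D ?u \<omega>)"
      unfolding excursion_def set_lebesgue_integral_def snd_conv by (rule integral_mult_right_zero)
    finally show "(LINT t|lborel. ?g t \<omega>) = exp (of_real (- s * D ?u \<omega>) + \<i> * of_real (k \<bullet> A ?u \<omega>)) *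
        excursion F (A (?u + 1 / 2 ^ n) \<omega> - A ?u \<omega>, D (?u + 1 / 2 ^ n) \<omega> - D ?u \<omega>)"
      by (simp add: grid_Suc)
  qed
  also have "\<dots> = exp (- (of_real ?u * \<psi> k s)) * (LINT \<omega>|M. excursion F (A (1 / 2 ^ n) \<omega>, D (1 / 2 ^ n) \<omega>))"
    by (rule factor[where B="1/s"]) (use s excursion_bound in auto)
  also have "exp (- (of_real ?u * \<psi> k s)) = exp (- (of_real (1 / 2 ^ n) * \<psi> k s)) ^ j"
    by (simp add: grid_def exp_of_nat_mult[symmetric])
  finally show ?thesis .
qed

text \<open>
  The steps partition the time axis and contribute a geometric series.
\<close>

theorem skeleton_renewal:
  "(LINT (t, \<omega>)|(lborel \<Otimes>\<^sub>M M). skeleton_functional n k s F t \<omega>) =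
     (LINT \<omega>|M. excursion F (A (1 / 2 ^ n) \<omega>, D (1 / 2 ^ n) \<omega>)) / (1 - exp (- (of_real (1 / 2 ^ n) * \<psi> k s)))"
proof -
  define B where "B j = {x. 0 \<le> fst x \<and> J n (fst x) (snd x) = j} \<inter> space (lborel \<Otimes>\<^sub>M M)" for j
  have B: "B j \<in> sets (lborel \<Otimes>\<^sub>M M)" for j
  proof -
    have "{x \<in> space (lborel \<Otimes>\<^sub>M M). 0 \<le> fst x \<and> (\<lambda>(t, \<omega>). J n t \<omega>) x = j} \<in> sets (lborel \<Otimes>\<^sub>M M)"
      by measurable
    then show ?thesis by (simp add: B_def case_prod_beta Int_def conj_commute)
  qed
  have "(LINT (t, \<omega>)|(lborel \<Otimes>\<^sub>M M). skeleton_functional n k s F t \<omega>) =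
      (LINT x:(\<Union>j. B j)|(lborel \<Otimes>\<^sub>M M). skeleton_functional n k s F (fst x) (snd x))"
    unfolding set_lebesgue_integral_def
    by (rule Bochner_Integration.integral_cong[OF refl])
       (auto simp: B_def indicator_def skeleton_functional_def)
  also have "\<dots> = (\<Sum>j. LINT x:B j|(lborel \<Otimes>\<^sub>M M). skeleton_functional n k s F (fst x) (snd x))"
  proof (rule lebesgue_integral_countable_add)
    show "set_integrable (lborel \<Otimes>\<^sub>M M) (\<Union>j. B j) (\<lambda>x. skeleton_functional n k s F (fst x) (snd x))"
      unfolding set_integrable_def
      using integrable_mult_indicator[OF sets.countable_UN[of B UNIV] skeleton_functional_integrable[of n k]] B
      by (auto simp: case_prod_beta)
  qed (use B in \<open>auto simp: B_def\<close>)
  also have "\<dots> = (\<Sum>j. exp (- (of_real (1 / 2 ^ n) * \<psi> k s)) ^ j * (LINT \<omega>|M. excursion F (A (1 / 2 ^ n) \<omega>, D (1 / 2 ^ n) \<omega>)))"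
    unfolding B_def cell_integral ..
  also have "\<dots> = (LINT \<omega>|M. excursion F (A (1 / 2 ^ n) \<omega>, D (1 / 2 ^ n) \<omega>)) / (1 - exp (- (of_real (1 / 2 ^ n) * \<psi> k s)))"
    using sums_mult2[OF geometric_sums[OF norm_transform_less_1[OF _ s, of "1 / 2 ^ n" k]],
        of "LINT \<omega>|M. excursion F (A (1 / 2 ^ n) \<omega>, D (1 / 2 ^ n) \<omega>)"]
    by (intro sums_unique[symmetric]) simp
  finally show ?thesis .
qed

end

section \<open>Limit of the skeletons\<close>

text \<open>
  The first point \<open>D(E(t))\<close> of the range at or above the level \<open>t \<ge> 0\<close>, written as a limit of dyadic
  expressions so that it is jointly measurable in \<open>t\<close> and \<open>\<omega>\<close>.
\<close>

definition overshoot :: "real \<Rightarrow> 'w \<Rightarrow> real" where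
  "overshoot t \<omega> = lim (\<lambda>n. D (grid n (Suc (J n t \<omega>))) \<omega>)"

lemma overshoot_eq:
  assumes "\<omega> \<in> space M" "0 \<le> t"
  shows "(\<lambda>n. D (grid n (Suc (J n t \<omega>))) \<omega>) \<longlonglongrightarrow> D (passage_time (\<lambda>r. D r \<omega>) t) \<omega>"
    and "overshoot t \<omega> = D (passage_time (\<lambda>r. D r \<omega>) t) \<omega>"
  unfolding overshoot_def
  using clock.upper_value_tendsto[OF clock clock.d_cadlag[OF clock], of \<omega> \<omega> t] assms
  by (auto intro: limI)

lemma overshoot_measurable [measurable]:
  "(\<lambda>(t, \<omega>). overshoot t \<omega>) \<in> borel_measurable (lborel \<Otimes>\<^sub>M M)"
proof -
  note grid_values_measurable[unfolded case_prod_beta, measurable]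
  show ?thesis unfolding overshoot_def case_prod_beta by measurable
qed

text \<open>
  The functional \<open>e\<^bsup>-v\<^esup> e\<^bsup>-\<sigma>\<bar>d - v\<bar>\<^esup>\<close> damps the distance from the elapsed
  time \<open>v\<close> to the end \<open>d\<close> of the step; the absolute value keeps it bounded by \<open>e\<^bsup>-v\<^esup>\<close> off the step.
\<close>

lemma excursion_overshoot:
  assumes \<sigma>: "1 < \<sigma>" and d: "0 \<le> d"
  shows "excursion (\<lambda>(v, a, d). of_real (exp (- v) * exp (- (\<sigma> * \<bar>d - v\<bar>)))) (a, d)
           = of_real ((exp (- d) - exp (- (\<sigma> * d))) / (\<sigma> - 1))"
proof -
  have "has_bochner_integral lborel (\<lambda>v. indicator {0..d} v *\<^sub>R exp ((\<sigma> - 1) * v - \<sigma> * d))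
      (exp ((\<sigma> - 1) * d - \<sigma> * d) / (\<sigma> - 1) - exp ((\<sigma> - 1) * 0 - \<sigma> * d) / (\<sigma> - 1))"
  proof (rule has_bochner_integral_FTC_Icc)
    show "((\<lambda>v. exp ((\<sigma> - 1) * v - \<sigma> * d) / (\<sigma> - 1)) has_vector_derivative exp ((\<sigma> - 1) * v - \<sigma> * d)) (at v within {0..d})" for v
      using \<sigma> by (auto intro!: derivative_eq_intros simp: has_real_derivative_iff_has_vector_derivative[symmetric])
  qed (use d in \<open>auto intro!: continuous_intros\<close>)
  then have "(LINT v|lborel. indicator {0..d} v *\<^sub>R exp ((\<sigma> - 1) * v - \<sigma> * d)) = (exp (- d) - exp (- (\<sigma> * d))) / (\<sigma> - 1)"
    by (subst has_bochner_integral_integral_eq) (auto simp: diff_divide_distrib algebra_simps)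
  moreover have "excursion (\<lambda>(v, a, d). of_real (exp (- v) * exp (- (\<sigma> * \<bar>d - v\<bar>)))) (a, d) =
      (LINT v|lborel. complex_of_real (indicator {0..d} v *\<^sub>R exp ((\<sigma> - 1) * v - \<sigma> * d)))"
    unfolding excursion_def set_lebesgue_integral_def
  proof (rule integral_cong_AE)
    show "AE v in lborel. indicat_real {0..<snd (a, d)} v *\<^sub>R
        (case (v, a, d) of (v, a, d) \<Rightarrow> complex_of_real (exp (- v) * exp (- (\<sigma> * \<bar>d - v\<bar>)))) =
        complex_of_real (indicator {0..d} v *\<^sub>R exp ((\<sigma> - 1) * v - \<sigma> * d))"
      using AE_lborel_singleton[of d]
      by eventually_elim (auto simp: indicator_def exp_add[symmetric] algebra_simps)
  qed auto
  ultimately show ?thesis by (simp only: integral_complex_of_real)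
qed

text \<open>
  At level \<open>n\<close> the renewal formula with \<open>k = 0\<close> and \<open>s = 1\<close> gives
  \<open>(e\<^bsup>-h\<^esup> - e\<^bsup>-h\<sigma>\<^sup>\<beta>\<^esup>) / ((\<sigma> - 1)(1 - e\<^bsup>-h\<^esup>))\<close>, where \<open>h = 2\<^sup>-\<^sup>n\<close>; now let \<open>h\<close> tend to \<open>0\<close>.
\<close>

theorem overshoot_transform:
  assumes \<sigma>: "1 < \<sigma>"
  shows "(LINT (t, \<omega>)|(lborel \<Otimes>\<^sub>M M). indicator {0..} t * exp (- t) * exp (- (\<sigma> * \<bar>overshoot t \<omega> - t\<bar>)))
           = (\<sigma> powr \<beta> - 1) / (\<sigma> - 1)"
proof -
  let ?F = "\<lambda>(v, a :: 'b, d). complex_of_real (exp (- v) * exp (- (\<sigma> * \<bar>d - v\<bar>)))"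
  let ?h = "\<lambda>n. 1 / 2 ^ n :: real"
  note grid_values_measurable[unfolded case_prod_beta, measurable] overshoot_measurable[unfolded case_prod_beta, measurable]
  have F_meas: "?F \<in> borel_measurable borel"
    unfolding case_prod_beta by (intro borel_measurable_continuous_onI continuous_intros)
  have F_bound: "norm (?F (v, z)) \<le> exp (- (1 * v))" if "0 \<le> v" for v z
    using \<sigma> by (auto simp: case_prod_beta norm_mult)
  have renewal: "(LINT (t, \<omega>)|(lborel \<Otimes>\<^sub>M M). skeleton_functional n 0 1 ?F t \<omega>) =
      of_real ((exp (- ?h n) - exp (- (?h n * \<sigma> powr \<beta>))) / (\<sigma> - 1) / (1 - exp (- ?h n)))" for n
  proof -
    have "(LINT \<omega>|M. excursion ?F (A (?h n) \<omega>, D (?h n) \<omega>)) =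
        (LINT \<omega>|M. complex_of_real ((exp (- (1 * D (?h n) \<omega>)) - exp (- (\<sigma> * D (?h n) \<omega>))) / (\<sigma> - 1)))"
      by (rule Bochner_Integration.integral_cong[OF refl]) (subst excursion_overshoot[OF \<sigma>], simp_all add: D_nonneg)
    also have "\<dots> = of_real ((exp (- ?h n) - exp (- (?h n * \<sigma> powr \<beta>))) / (\<sigma> - 1))"
    proof -
      have int: "integrable M (\<lambda>\<omega>. exp (- (r * D (?h n) \<omega>)))" if "0 \<le> r" for r
        using that D_nonneg[of _ "?h n"] D_meas[of "?h n"]
        by (intro P.integrable_const_bound[where B=1]) (auto intro!: AE_I2)
      show ?thesis
        unfolding integral_complex_of_real using int[of 1] int[of \<sigma>] \<sigma> laplace_D[of "?h n" 1] laplace_D[of "?h n" \<sigma>]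
        by (simp add: Bochner_Integration.integral_diff)
    qed
    finally show ?thesis
      using skeleton_renewal[OF zero_less_one F_meas F_bound, of n 0]
      by (simp add: symbol_zero exp_of_real[symmetric])
  qed
  let ?f = "\<lambda>(t, \<omega>). complex_of_real (indicator {0..} t * exp (- t) * exp (- (\<sigma> * \<bar>overshoot t \<omega> - t\<bar>)))"
  have lim: "(\<lambda>n. LINT (t, \<omega>)|(lborel \<Otimes>\<^sub>M M). skeleton_functional n 0 1 ?F t \<omega>) \<longlonglongrightarrow> (LINT x|(lborel \<Otimes>\<^sub>M M). ?f x)"
  proof (rule integral_dominated_convergence[OF _ _ exp_neg_integrable_pair[OF zero_less_one, unfolded case_prod_beta]])
    show "AE x in lborel \<Otimes>\<^sub>M M. (\<lambda>n. (\<lambda>(t, \<omega>). skeleton_functional n 0 1 ?F t \<omega>) x) \<longlonglongrightarrow> ?f x"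
    proof (rule AE_I2)
      fix x :: "real \<times> 'w" assume space: "x \<in> space (lborel \<Otimes>\<^sub>M M)"
      obtain t \<omega> where x: "x = (t, \<omega>)" by (cases x)
      have \<omega>: "\<omega> \<in> space M" using space by (auto simp: x space_pair_measure)
      show "(\<lambda>n. (\<lambda>(t, \<omega>). skeleton_functional n 0 1 ?F t \<omega>) x) \<longlonglongrightarrow> ?f x"
      proof (cases "0 \<le> t")
        case True
        have eq: "skeleton_functional n 0 1 ?F t \<omega> =
            complex_of_real (exp (- t) * exp (- (\<sigma> * \<bar>D (grid n (Suc (J n t \<omega>))) \<omega> - t\<bar>)))" for n
          using True by (simp add: skeleton_functional_def Let_def exp_of_real[symmetric] exp_add[symmetric] algebra_simps)
        show ?thesis
          using True \<omega> unfolding x prod.case eq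
          by (auto intro!: tendsto_intros overshoot_eq simp: overshoot_eq(2))
      qed (simp add: x skeleton_functional_def)
    qed
    show "AE x in lborel \<Otimes>\<^sub>M M. norm ((\<lambda>(t, \<omega>). skeleton_functional n 0 1 ?F t \<omega>) x) \<le> indicator {0..} (fst x) * exp (- (1 * fst x))" for n
    proof (rule AE_I2)
      fix x :: "real \<times> 'w" assume "x \<in> space (lborel \<Otimes>\<^sub>M M)"
      then show "norm ((\<lambda>(t, \<omega>). skeleton_functional n 0 1 ?F t \<omega>) x) \<le> indicator {0..} (fst x) * exp (- (1 * fst x))"
        using skeleton_functional_bound[OF zero_less_one F_meas F_bound, of "snd x"] by (cases x) (simp add: space_pair_measure)
    qed
    show "(\<lambda>(t, \<omega>). skeleton_functional n 0 1 ?F t \<omega>) \<in> borel_measurable (lborel \<Otimes>\<^sub>M M)" for n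
      by (rule skeleton_functional_measurable[OF zero_less_one F_meas F_bound])
    show "?f \<in> borel_measurable (lborel \<Otimes>\<^sub>M M)" unfolding case_prod_beta by measurable
  qed
  have h: "filterlim ?h (at_right 0) sequentially"
    by (intro tendsto_imp_filterlim_at_right LIMSEQ_divide_realpow_zero) auto
  have "((\<lambda>h. (exp (- h) - exp (- (h * c))) / (1 - exp (- h))) \<longlongrightarrow> c - 1) (at_right 0)" if "1 < c" for c :: real
    using that by real_asymp
  from tendsto_divide[OF this[of "\<sigma> powr \<beta>"] tendsto_const[of "\<sigma> - 1"]]
  have "((\<lambda>h. (exp (- h) - exp (- (h * \<sigma> powr \<beta>))) / (\<sigma> - 1) / (1 - exp (- h))) \<longlongrightarrow> (\<sigma> powr \<beta> - 1) / (\<sigma> - 1)) (at_right 0)"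
    using \<sigma> \<beta> by (simp add: gr_one_powr divide_divide_eq_left mult.commute)
  from filterlim_compose[OF this h]
  have "(\<lambda>n. complex_of_real ((exp (- ?h n) - exp (- (?h n * \<sigma> powr \<beta>))) / (\<sigma> - 1) / (1 - exp (- ?h n)))) \<longlonglongrightarrow> of_real ((\<sigma> powr \<beta> - 1) / (\<sigma> - 1))"
    by (intro tendsto_of_real)
  from LIMSEQ_unique[OF lim[unfolded renewal] this] show ?thesis
    unfolding case_prod_beta integral_complex_of_real of_real_eq_iff .
qed

text \<open>
  On the pairs with \<open>overshoot t \<omega> = t\<close> the integrand of the preceding identity is \<open>e\<^bsup>-t\<^esup>\<close> for every
  \<open>\<sigma>\<close>, but the right-hand side vanishes as \<open>\<sigma> \<rightarrow> \<infinity>\<close> because \<open>\<beta> < 1\<close>.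
\<close>

theorem overshoot_ne: "AE x in lborel \<Otimes>\<^sub>M M. 0 \<le> fst x \<longrightarrow> overshoot (fst x) (snd x) \<noteq> fst x"
proof -
  note overshoot_measurable[unfolded case_prod_beta, measurable]
  define f :: "real \<times> 'w \<Rightarrow> real" where
    "f x = indicator {0..} (fst x) * exp (- fst x) * (if overshoot (fst x) (snd x) = fst x then 1 else 0)" for x
  define g where "g \<sigma> x = indicator {0..} (fst x) * exp (- fst x) * exp (- (\<sigma> * \<bar>overshoot (fst x) (snd x) - fst x\<bar>))" for \<sigma> x
  have [measurable]: "f \<in> borel_measurable (lborel \<Otimes>\<^sub>M M)" unfolding f_def[abs_def] by measurable
  have [measurable]: "g \<sigma> \<in> borel_measurable (lborel \<Otimes>\<^sub>M M)" for \<sigma> unfolding g_def[abs_def] by measurable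
  note base = exp_neg_integrable_pair[OF zero_less_one, unfolded case_prod_beta]
  have f_int: "integrable (lborel \<Otimes>\<^sub>M M) f"
    by (rule Bochner_Integration.integrable_bound[OF base]) (auto simp: f_def indicator_def)
  have g_int: "integrable (lborel \<Otimes>\<^sub>M M) (g \<sigma>)" if "1 < \<sigma>" for \<sigma>
    by (rule Bochner_Integration.integrable_bound[OF base]) (use that in \<open>auto simp: g_def indicator_def\<close>)
  have "(LINT x|(lborel \<Otimes>\<^sub>M M). f x) \<le> (\<sigma> powr \<beta> - 1) / (\<sigma> - 1)" if "1 < \<sigma>" for \<sigma>
  proof -
    have "(LINT x|(lborel \<Otimes>\<^sub>M M). f x) \<le> (LINT x|(lborel \<Otimes>\<^sub>M M). g \<sigma> x)"
      by (rule integral_mono[OF f_int g_int[OF that]]) (auto simp: f_def g_def indicator_def)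
    then show ?thesis using overshoot_transform[OF that] unfolding g_def case_prod_unfold by simp
  qed
  moreover have "((\<lambda>\<sigma>. (\<sigma> powr \<beta> - 1) / (\<sigma> - 1)) \<longlongrightarrow> 0) at_top"
    using \<beta> by real_asymp
  ultimately have "(LINT x|(lborel \<Otimes>\<^sub>M M). f x) \<le> 0"
    by (intro tendsto_lowerbound[where F=at_top]) (auto intro!: eventually_mono[OF eventually_gt_at_top[of 1]])
  moreover have "0 \<le> (LINT x|(lborel \<Otimes>\<^sub>M M). f x)" by (rule integral_nonneg_AE) (auto simp: f_def)
  ultimately have "(LINT x|(lborel \<Otimes>\<^sub>M M). f x) = 0" by simp
  moreover have "AE x in lborel \<Otimes>\<^sub>M M. 0 \<le> f x" by (rule AE_I2) (simp add: f_def)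
  ultimately have "AE x in lborel \<Otimes>\<^sub>M M. f x = 0"
    using integral_nonneg_eq_0_iff_AE[OF f_int] by blast
  then show ?thesis
    by eventually_elim (auto simp: f_def split: if_splits)
qed

abbreviation "walk t \<omega> \<equiv> levy_walk (\<lambda>r. A r \<omega>) (\<lambda>r. D r \<omega>) t"

text \<open>
  A jointly measurable expression for the walk at every \<open>t \<ge> 0\<close>. The case distinction is there because
  on the range of \<open>D\<close> the chords need not converge to the walk.
\<close>

definition walk_version :: "real \<Rightarrow> 'w \<Rightarrow> 'b" where
  "walk_version t \<omega> = lim (\<lambda>n. if overshoot t \<omega> = t then A (grid n (Suc (J n t \<omega>))) \<omega>
       else chord n (\<lambda>r. A r \<omega>) (\<lambda>r. D r \<omega>) t)"

lemma walk_eq_version: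
  assumes \<omega>: "\<omega> \<in> space M" and t: "0 \<le> t"
  shows "walk t \<omega> = walk_version t \<omega>"
proof (cases "D (passage_time (\<lambda>r. D r \<omega>) t) \<omega> = t")
  case True
  then show ?thesis
    unfolding walk_version_def overshoot_eq(2)[OF assms]
    using clock.levy_walk_on_range[OF clock[OF \<omega>] A_cadlag[OF \<omega>] t] by (simp add: limI)
next
  case False
  then show ?thesis
    unfolding walk_version_def overshoot_eq(2)[OF assms]
    using clock.levy_walk_off_range[OF clock[OF \<omega>] A_cadlag[OF \<omega>] t] by (simp add: limI)
qed

lemma walk_version_measurable [measurable]:
  "(\<lambda>(t, \<omega>). walk_version t \<omega>) \<in> borel_measurable (lborel \<Otimes>\<^sub>M M)"
proof -
  note grid_values_measurable[unfolded case_prod_beta, measurable] overshoot_measurable[unfolded case_prod_beta, measurable]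
  show ?thesis unfolding walk_version_def chord_def case_prod_beta by measurable
qed

text \<open>
  The skeletons have the transform \<open>\<phi>/\<psi>\<close> at every level and converge almost everywhere to the walk,
  dominated by \<open>e\<^bsup>-st\<^esup>\<close>.
\<close>

theorem walk_fourier_laplace_pair:
  assumes s: "0 < s"
  shows "integrable (lborel \<Otimes>\<^sub>M M) (\<lambda>(t, \<omega>). indicator {0..} t *\<^sub>R (of_real (exp (- s * t)) * exp (\<i> * of_real (k \<bullet> walk_version t \<omega>))))"
    and "\<psi> k s * (LINT (t, \<omega>)|(lborel \<Otimes>\<^sub>M M). indicator {0..} t *\<^sub>R (of_real (exp (- s * t)) * exp (\<i> * of_real (k \<bullet> walk_version t \<omega>)))) = \<phi> k s"
proof -
  \<comment> \<open>With this functional the skeleton is the exponential of the polygon.\<close>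
  let ?F = "\<lambda>(v, a :: 'b, d). exp (complex_of_real (- s * v) + \<i> * of_real ((v / d) * (k \<bullet> a)))"
  let ?h = "\<lambda>n. 1 / 2 ^ n :: real"
  let ?f = "\<lambda>(t, \<omega>). indicator {0..} t *\<^sub>R (of_real (exp (- s * t)) * exp (\<i> * of_real (k \<bullet> walk_version t \<omega>)))"
  note grid_values_measurable[unfolded case_prod_beta, measurable] walk_version_measurable[unfolded case_prod_beta, measurable]
  have F_meas: "?F \<in> borel_measurable borel"
  proof -
    have [measurable]: "(\<lambda>p. snd (snd p)) \<in> borel_measurable (borel :: (real \<times> 'b \<times> real) measure)"
      "(\<lambda>p. fst (snd p)) \<in> borel_measurable (borel :: (real \<times> 'b \<times> real) measure)"
      "fst \<in> borel_measurable (borel :: (real \<times> 'b \<times> real) measure)"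
      by (intro borel_measurable_continuous_onI continuous_intros)+
    show ?thesis unfolding case_prod_beta by measurable
  qed
  have F_bound: "norm (?F (v, z)) \<le> exp (- (s * v))" for v z
    by (auto simp: case_prod_beta)
  note base = exp_neg_integrable_pair[OF s, unfolded case_prod_beta]
  show int: "integrable (lborel \<Otimes>\<^sub>M M) ?f"
    unfolding case_prod_beta
    by (rule Bochner_Integration.integrable_bound[OF base]) (auto simp: norm_mult)
  have renewal: "(LINT (t, \<omega>)|(lborel \<Otimes>\<^sub>M M). skeleton_functional n k s ?F t \<omega>) = \<phi> k s / \<psi> k s" for n
  proof -
    have "norm (exp (- (of_real (?h n) * \<psi> k s))) < 1"
      by (rule norm_transform_less_1[OF _ s]) simp
    then have "exp (- (of_real (?h n) * \<psi> k s)) \<noteq> 1"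
      by (metis less_irrefl norm_one)
    then have "1 - exp (- (of_real (?h n) * \<psi> k s)) \<noteq> 0"
      by simp
    moreover have "(LINT \<omega>|M. excursion ?F (A (?h n) \<omega>, D (?h n) \<omega>)) = \<phi> k s * (1 - exp (- (of_real (?h n) * \<psi> k s))) / \<psi> k s"
      unfolding excursion_def prod.case fst_conv snd_conv
      by (rule stable_increment.excursion_moment[OF increment s symbol_nonzero[OF s]]) simp
    ultimately show ?thesis
      using skeleton_renewal[OF s F_meas F_bound, of n k] by simp
  qed
  have lim: "(\<lambda>n. LINT (t, \<omega>)|(lborel \<Otimes>\<^sub>M M). skeleton_functional n k s ?F t \<omega>) \<longlonglongrightarrow> (LINT x|(lborel \<Otimes>\<^sub>M M). ?f x)"
  proof (rule integral_dominated_convergence[OF _ _ base])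
    show "AE x in lborel \<Otimes>\<^sub>M M. (\<lambda>n. (\<lambda>(t, \<omega>). skeleton_functional n k s ?F t \<omega>) x) \<longlonglongrightarrow> ?f x"
      using overshoot_ne AE_space
    proof eventually_elim
      case (elim x)
      obtain t \<omega> where x: "x = (t, \<omega>)" by (cases x)
      have \<omega>: "\<omega> \<in> space M" using elim(2) by (auto simp: x space_pair_measure)
      show ?case
      proof (cases "0 \<le> t")
        case True
        have eq: "skeleton_functional n k s ?F t \<omega> =
            of_real (exp (- s * t)) * exp (\<i> * of_real (k \<bullet> chord n (\<lambda>r. A r \<omega>) (\<lambda>r. D r \<omega>) t))" for n
        proof -
          let ?u = "grid n (J n t \<omega>)" and ?v = "grid n (Suc (J n t \<omega>))"
          define r where "r = (t - D ?u \<omega>) / (D ?v \<omega> - D ?u \<omega>)"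
          have chord_eq: "k \<bullet> chord n (\<lambda>r. A r \<omega>) (\<lambda>r. D r \<omega>) t = k \<bullet> A ?u \<omega> + r * (k \<bullet> (A ?v \<omega> - A ?u \<omega>))"
            by (simp add: chord_def inner_add_right r_def)
          have "skeleton_functional n k s ?F t \<omega> = exp (of_real (- s * D ?u \<omega>) + \<i> * of_real (k \<bullet> A ?u \<omega>)) *
              exp (of_real (- s * (t - D ?u \<omega>)) + \<i> * of_real (r * (k \<bullet> (A ?v \<omega> - A ?u \<omega>))))"
            using True by (simp add: skeleton_functional_def Let_def r_def)
          also have "\<dots> = exp (of_real (- s * t) + \<i> * of_real (k \<bullet> chord n (\<lambda>r. A r \<omega>) (\<lambda>r. D r \<omega>) t))"
            unfolding exp_add[symmetric] chord_eq by (simp add: algebra_simps)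
          also have "\<dots> = of_real (exp (- s * t)) * exp (\<i> * of_real (k \<bullet> chord n (\<lambda>r. A r \<omega>) (\<lambda>r. D r \<omega>) t))"
            unfolding exp_add exp_of_real ..
          finally show ?thesis .
        qed
        have "D (passage_time (\<lambda>r. D r \<omega>) t) \<omega> \<noteq> t"
          using elim(1) True overshoot_eq(2)[OF \<omega> True] by (simp add: x)
        then have "(\<lambda>n. chord n (\<lambda>r. A r \<omega>) (\<lambda>r. D r \<omega>) t) \<longlonglongrightarrow> walk_version t \<omega>"
          using clock.levy_walk_off_range[OF clock[OF \<omega>] A_cadlag[OF \<omega>] True] by (simp add: walk_eq_version[OF \<omega> True])
        then show ?thesis
          using True unfolding x prod.case eq by (auto intro!: tendsto_intros)
      qed (simp add: x skeleton_functional_def)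
    qed
    show "AE x in lborel \<Otimes>\<^sub>M M. norm ((\<lambda>(t, \<omega>). skeleton_functional n k s ?F t \<omega>) x) \<le> indicator {0..} (fst x) * exp (- (s * fst x))" for n
    proof (rule AE_I2)
      fix x :: "real \<times> 'w" assume "x \<in> space (lborel \<Otimes>\<^sub>M M)"
      then show "norm ((\<lambda>(t, \<omega>). skeleton_functional n k s ?F t \<omega>) x) \<le> indicator {0..} (fst x) * exp (- (s * fst x))"
        using skeleton_functional_bound[OF s F_meas F_bound, of "snd x"] by (cases x) (simp add: space_pair_measure)
    qed
    show "(\<lambda>(t, \<omega>). skeleton_functional n k s ?F t \<omega>) \<in> borel_measurable (lborel \<Otimes>\<^sub>M M)" for n
      by (rule skeleton_functional_measurable[OF s F_meas F_bound])
    show "?f \<in> borel_measurable (lborel \<Otimes>\<^sub>M M)" using int by auto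
  qed
  have "(LINT x|(lborel \<Otimes>\<^sub>M M). ?f x) = \<phi> k s / \<psi> k s"
    using LIMSEQ_unique[OF lim[unfolded renewal] tendsto_const] .
  then show "\<psi> k s * (LINT x|(lborel \<Otimes>\<^sub>M M). ?f x) = \<phi> k s"
    using symbol_nonzero[OF s] by simp
qed

lemma walk_version_measurable_time [measurable]: "walk_version t \<in> borel_measurable M"
  using measurable_compose[OF measurable_Pair1'[of t lborel M] walk_version_measurable] by simp

theorem walk_fourier_laplace:
  assumes s: "0 < s"
  shows "set_integrable lborel {0<..} (\<lambda>t. of_real (exp (- s * t)) * (LINT \<omega>|M. exp (\<i> * of_real (k \<bullet> walk_version t \<omega>))))"
    and "\<psi> k s * (LINT t:{0<..}|lborel. of_real (exp (- s * t)) * (LINT \<omega>|M. exp (\<i> * of_real (k \<bullet> walk_version t \<omega>)))) = \<phi> k s"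
proof -
  let ?c = "\<lambda>t. of_real (exp (- s * t)) * (LINT \<omega>|M. exp (\<i> * of_real (k \<bullet> walk_version t \<omega>)))"
  have inner: "(LINT \<omega>|M. indicator {0..} t *\<^sub>R (of_real (exp (- s * t)) * exp (\<i> * of_real (k \<bullet> walk_version t \<omega>)))) =
      indicator {0..} t *\<^sub>R ?c t" for t
    by simp
  have "integrable lborel (\<lambda>t. indicator {0..} t *\<^sub>R ?c t)"
    using TM.integrable_fst[OF walk_fourier_laplace_pair(1)[OF s, of k]] unfolding inner .
  then have int: "set_integrable lborel {0..} ?c" unfolding set_integrable_def .
  then show int': "set_integrable lborel {0<..} ?c"
    by (rule set_integrable_subset) auto
  have "(LINT t:{0<..}|lborel. ?c t) = (LINT t:{0..}|lborel. ?c t)"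
    unfolding set_lebesgue_integral_def
    by (rule integral_cong_AE)
       (use int int' AE_lborel_singleton[of 0] in \<open>auto simp: set_integrable_def indicator_def elim!: eventually_mono\<close>)
  also have "\<dots> = (LINT t|lborel. indicator {0..} t *\<^sub>R ?c t)"
    unfolding set_lebesgue_integral_def ..
  also have "\<dots> = (LINT (t, \<omega>)|(lborel \<Otimes>\<^sub>M M). indicator {0..} t *\<^sub>R (of_real (exp (- s * t)) * exp (\<i> * of_real (k \<bullet> walk_version t \<omega>))))"
    using TM.integral_fst[OF walk_fourier_laplace_pair(1)[OF s, of k]] unfolding inner .
  finally show "\<psi> k s * (LINT t:{0<..}|lborel. ?c t) = \<phi> k s"
    using walk_fourier_laplace_pair(2)[OF s, of k] by simp
qed

end

section \<open>From the Levy process to regular paths\<close>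

text \<open>
  The bound may depend on any parameter along which it vanishes; below it is a real argument of a
  Laplace transform or a natural number.
\<close>

lemma (in prob_space) AE_not_if_prob_vanishes:
  fixes c :: "'i \<Rightarrow> real"
  assumes P: "{x \<in> space M. P x} \<in> events" and F: "F \<noteq> bot" "(c \<longlongrightarrow> 0) F"
    and bound: "eventually (\<lambda>i. prob {x \<in> space M. P x} \<le> c i) F"
  shows "AE x in M. \<not> P x"
proof -
  have "prob {x \<in> space M. P x} \<le> 0"
    by (rule tendsto_lowerbound[OF F(2) bound F(1)])
  then have "prob {x \<in> space M. P x} = 0" using measure_nonneg[of M] by (simp add: antisym)
  then show ?thesis using P by (subst (asm) prob_Collect_eq_0) auto
qed

text \<open>
  Monotonicity on the rationals passes to the reals by right-continuity. It stays strict since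
  two rationals fit between any two reals.
\<close>

lemma clock_pathI:
  assumes d: "cadlag d" "d 0 = 0"
    and mono: "\<And>q r. q \<in> \<rat> \<Longrightarrow> r \<in> \<rat> \<Longrightarrow> 0 \<le> q \<Longrightarrow> q < r \<Longrightarrow> d q < d r"
    and unbounded: "\<And>m::nat. \<exists>n::nat. real m < d (real n)"
  shows "clock_path d"
  unfolding clock_path_def
proof (intro conjI d allI)
  have before: "d x \<le> d q" if x: "0 \<le> x" "x < q" "q \<in> \<rat>" for x q
  proof (rule ccontr)
    assume "\<not> d x \<le> d q"
    then have "eventually (\<lambda>r. d q < d r) (at_right x)"
      using order_tendstoD(1)[OF cadlag_right_limit[OF d(1) x(1)]] by simp
    then obtain b where b: "x < b" "\<And>r. x < r \<Longrightarrow> r < b \<Longrightarrow> d q < d r"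
      unfolding eventually_at_right_field by blast
    obtain r where "r \<in> \<rat>" "x < r" "r < min b q"
      using Rats_dense_in_real[of x "min b q"] b x by auto
    then show False using b(2)[of r] mono[of r q] x by auto
  qed
  have after: "d q \<le> d y" if y: "0 \<le> q" "q < y" "q \<in> \<rat>" for y q
  proof (rule ccontr)
    assume "\<not> d q \<le> d y"
    moreover have "0 \<le> y" using y by simp
    ultimately have "eventually (\<lambda>r. d r < d q) (at_right y)"
      using order_tendstoD(2)[OF cadlag_right_limit[OF d(1)], of y "d q"] by simp
    then obtain b where b: "y < b" "\<And>r. y < r \<Longrightarrow> r < b \<Longrightarrow> d r < d q"
      unfolding eventually_at_right_field by blast
    obtain r where "r \<in> \<rat>" "y < r" "r < b"
      using Rats_dense_in_real[of y b] b by auto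
    then show False using b(2)[of r] mono[of q r] y by auto
  qed
  show "strict_mono_on {0..} d"
  proof (rule strict_mono_onI)
    fix x y :: real assume xy: "x \<in> {0..}" "y \<in> {0..}" "x < y"
    obtain q where q: "q \<in> \<rat>" "x < q" "q < y" using Rats_dense_in_real[OF xy(3)] by auto
    obtain r where r: "r \<in> \<rat>" "q < r" "r < y" using Rats_dense_in_real[OF q(3)] by auto
    have "d x \<le> d q" using xy q by (intro before) auto
    also have "\<dots> < d r" using xy q r by (intro mono) auto
    also have "\<dots> \<le> d y" using xy q r by (intro after) auto
    finally show "d x < d y" .
  qed
  fix t :: real
  obtain m :: nat where "t < real m" using reals_Archimedean2 by blast
  then show "\<exists>u\<ge>0. t < d u" using unbounded[of m] by (meson of_nat_0_le_iff order_less_trans)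
qed

lemma cadlag_fst_snd:
  assumes "cadlag (\<lambda>t. (a t, d t))"
  shows "cadlag a" "cadlag d"
proof -
  have right: "((\<lambda>t. (a t, d t)) \<longlongrightarrow> (a t, d t)) (at_right t)" if "0 \<le> t" for t
    using assms that by (simp add: cadlag_def)
  have left: "\<exists>l. ((\<lambda>t. (a t, d t)) \<longlongrightarrow> l) (at_left t)" if "0 < t" for t
    using assms that unfolding cadlag_def by blast
  show "cadlag a"
    unfolding cadlag_def
  proof (intro conjI allI impI)
    show "(a \<longlongrightarrow> a t) (at_right t)" if "0 \<le> t" for t
      using tendsto_fst[OF right[OF that]] by simp
    show "\<exists>l. (a \<longlongrightarrow> l) (at_left t)" if t: "0 < t" for t
    proof -
      obtain l where "((\<lambda>t. (a t, d t)) \<longlongrightarrow> l) (at_left t)" using left[OF t] by blast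
      then show ?thesis using tendsto_fst by fastforce
    qed
  qed
  show "cadlag d"
    unfolding cadlag_def
  proof (intro conjI allI impI)
    show "(d \<longlongrightarrow> d t) (at_right t)" if "0 \<le> t" for t
      using tendsto_snd[OF right[OF that]] by simp
    show "\<exists>l. (d \<longlongrightarrow> l) (at_left t)" if t: "0 < t" for t
    proof -
      obtain l where "((\<lambda>t. (a t, d t)) \<longlongrightarrow> l) (at_left t)" using left[OF t] by blast
      then show ?thesis using tendsto_snd by fastforce
    qed
  qed
qed

lemma cadlag_const: "cadlag (\<lambda>t. c)"
  by (auto simp: cadlag_def)

lemma clock_path_id: "clock_path (\<lambda>t. t)"
  unfolding clock_path_def
proof (intro conjI allI)
  show "cadlag (\<lambda>t::real. t)" unfolding cadlag_def by (blast intro: tendsto_ident_at)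
  show "\<exists>u\<ge>0. t < u" for t :: real by (intro exI[of _ "max t 0 + 1"]) auto
qed (auto intro: strict_mono_onI)

text \<open>
  Apply independence of increments to the times \<open>0, u, u + h\<close>, and use \<open>Z 0 = 0\<close> almost surely.
\<close>

lemma (in prob_space) levy_process_factor:
  fixes Z :: "real \<Rightarrow> 'a \<Rightarrow> 'c::euclidean_space" and f g :: "'c \<Rightarrow> complex"
  assumes levy: "levy_process Z" and u: "0 \<le> u" and h: "0 \<le> h"
    and f [measurable]: "f \<in> borel_measurable borel" and g [measurable]: "g \<in> borel_measurable borel"
    and f_int: "integrable M (\<lambda>\<omega>. f (Z u \<omega>))" and g_int: "integrable M (\<lambda>\<omega>. g (Z h \<omega>))"
  shows "(LINT \<omega>|M. f (Z u \<omega>) * g (Z (u + h) \<omega> - Z u \<omega>)) = (LINT \<omega>|M. f (Z u \<omega>)) * (LINT \<omega>|M. g (Z h \<omega>))"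
proof -
  have Z_meas: "random_variable borel (Z t)" if "0 \<le> t" for t
    using levy that by (simp add: levy_process_def)
  note [measurable] = Z_meas[OF u] Z_meas[OF h] Z_meas[of 0, OF order_refl] Z_meas[OF add_nonneg_nonneg[OF u h]]
  have Z0: "AE \<omega> in M. Z 0 \<omega> = 0" using levy by (simp add: levy_process_def)
  have stationary: "distr M borel (\<lambda>\<omega>. Z (u + h) \<omega> - Z u \<omega>) = distr M borel (Z h)"
    using levy u h by (simp add: levy_process_def)
  \<comment> \<open>The times \<open>0, u, u + h, u + h, \<dots>\<close>, of which the first two increments matter.\<close>
  define \<tau> :: "nat \<Rightarrow> real" where "\<tau> i = (if i = 0 then 0 else if i = 1 then u else u + h)" for i
  have "0 \<le> \<tau> 0" by (simp add: \<tau>_def)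
  have "incseq \<tau>" using u h by (intro incseq_SucI) (auto simp: \<tau>_def)
  then have "indep_vars (\<lambda>_. borel) (\<lambda>i \<omega>. Z (\<tau> (Suc i)) \<omega> - Z (\<tau> i) \<omega>) {..<2}"
    using levy \<open>0 \<le> \<tau> 0\<close> unfolding levy_process_def by blast
  then have indep: "indep_vars (\<lambda>_. borel) (\<lambda>i \<omega>. (if i = 0 then f else g) (Z (\<tau> (Suc i)) \<omega> - Z (\<tau> i) \<omega>)) {..<2}"
    by (rule indep_vars_compose2) simp
  have f_int': "integrable M (\<lambda>\<omega>. f (Z u \<omega> - Z 0 \<omega>))"
    by (rule integrable_cong_AE_imp[OF f_int]) (use Z0 in \<open>auto elim!: eventually_mono\<close>)
  have g_int': "integrable M (\<lambda>\<omega>. g (Z (u + h) \<omega> - Z u \<omega>))"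
    using g_int integrable_distr_eq[of "\<lambda>\<omega>. Z (u + h) \<omega> - Z u \<omega>" M borel g] integrable_distr_eq[of "Z h" M borel g]
    by (simp add: stationary)
  have "(LINT \<omega>|M. (\<Prod>i\<in>{..<2::nat}. (if i = 0 then f else g) (Z (\<tau> (Suc i)) \<omega> - Z (\<tau> i) \<omega>))) =
      (\<Prod>i\<in>{..<2::nat}. LINT \<omega>|M. (if i = 0 then f else g) (Z (\<tau> (Suc i)) \<omega> - Z (\<tau> i) \<omega>))"
    by (rule indep_vars_lebesgue_integral[OF _ indep]) (use f_int' g_int' in \<open>auto simp: \<tau>_def less_2_cases_iff\<close>)
  then have "(LINT \<omega>|M. f (Z u \<omega> - Z 0 \<omega>) * g (Z (u + h) \<omega> - Z u \<omega>)) =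
      (LINT \<omega>|M. f (Z u \<omega> - Z 0 \<omega>)) * (LINT \<omega>|M. g (Z (u + h) \<omega> - Z u \<omega>))"
    by (simp add: \<tau>_def numeral_2_eq_2 lessThan_Suc mult.commute)
  moreover have "(LINT \<omega>|M. f (Z u \<omega> - Z 0 \<omega>) * g (Z (u + h) \<omega> - Z u \<omega>)) = (LINT \<omega>|M. f (Z u \<omega>) * g (Z (u + h) \<omega> - Z u \<omega>))"
    by (rule integral_cong_AE) (use Z0 in \<open>auto elim!: eventually_mono\<close>)
  moreover have "(LINT \<omega>|M. f (Z u \<omega> - Z 0 \<omega>)) = (LINT \<omega>|M. f (Z u \<omega>))"
    by (rule integral_cong_AE) (use Z0 in \<open>auto elim!: eventually_mono\<close>)
  moreover have "(LINT \<omega>|M. g (Z (u + h) \<omega> - Z u \<omega>)) = (LINT \<omega>|M. g (Z h \<omega>))"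
    using integral_distr[of "\<lambda>\<omega>. Z (u + h) \<omega> - Z u \<omega>" M borel g] integral_distr[of "Z h" M borel g]
    by (simp add: stationary)
  ultimately show ?thesis by simp
qed

locale walk_process = spectral_measure \<Lambda> \<beta> + P: prob_space M
  for \<Lambda> :: "'b::euclidean_space measure" and \<beta> and M :: "'w measure" +
  fixes A :: "real \<Rightarrow> 'w \<Rightarrow> 'b" and D :: "real \<Rightarrow> 'w \<Rightarrow> real"
  assumes levy: "P.levy_process (\<lambda>t \<omega>. (A t \<omega>, D t \<omega>))"
    and nonneg: "AE \<omega> in M. \<forall>t\<ge>0. 0 \<le> D t \<omega>"
    and transform: "0 \<le> t \<Longrightarrow> 0 \<le> s \<Longrightarrow>
      (LINT \<omega>|M. exp (of_real (- s * D t \<omega>) + \<i> * of_real (k \<bullet> A t \<omega>))) = exp (- (of_real t * \<psi> k s))"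
begin

lemma pair_meas: "0 \<le> t \<Longrightarrow> (\<lambda>\<omega>. (A t \<omega>, D t \<omega>)) \<in> borel_measurable M"
  using levy by (simp add: P.levy_process_def)

lemma A_meas: "0 \<le> t \<Longrightarrow> A t \<in> borel_measurable M"
  and D_meas: "0 \<le> t \<Longrightarrow> D t \<in> borel_measurable M"
  using measurable_compose[OF pair_meas, of t fst borel] measurable_compose[OF pair_meas, of t snd borel]
  by (auto simp: borel_prod[symmetric])

lemma exp_D_integrable:
  assumes "0 \<le> t" "0 \<le> s" shows "integrable M (\<lambda>\<omega>. exp (- (s * D t \<omega>)))"
proof (rule P.integrable_const_bound[where B=1])
  note D_meas[OF assms(1), measurable]
  show "AE \<omega> in M. norm (exp (- (s * D t \<omega>))) \<le> 1"
    using nonneg by eventually_elim (use assms in auto)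
  show "(\<lambda>\<omega>. exp (- (s * D t \<omega>))) \<in> borel_measurable M" by measurable
qed

lemma laplace_D:
  assumes "0 \<le> t" "0 \<le> s"
  shows "(LINT \<omega>|M. exp (- (s * D t \<omega>))) = exp (- (t * s powr \<beta>))"
proof -
  have "complex_of_real (LINT \<omega>|M. exp (- (s * D t \<omega>))) = of_real (exp (- (t * s powr \<beta>)))"
    using transform[OF assms, of 0] assms(2)
    by (simp add: symbol_zero integral_complex_of_real[symmetric] exp_of_real[symmetric])
  then show ?thesis using of_real_eq_iff by blast
qed

text \<open>
  Markov's inequality for \<open>e\<^bsup>-sD(t)\<^esup>\<close>.
\<close>

lemma prob_le_exp:
  assumes "0 \<le> t" "0 \<le> s" and ev: "{\<omega> \<in> space M. Q \<omega>} \<in> sets M" and Q: "\<And>\<omega>. \<omega> \<in> space M \<Longrightarrow> Q \<omega> \<Longrightarrow> D t \<omega> \<le> m"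
  shows "P.prob {\<omega> \<in> space M. Q \<omega>} \<le> exp (s * m - t * s powr \<beta>)"
proof -
  have "P.prob {\<omega> \<in> space M. Q \<omega>} = (LINT \<omega>|M. indicator {\<omega> \<in> space M. Q \<omega>} \<omega>)"
    using ev by simp
  also have "\<dots> \<le> (LINT \<omega>|M. exp (s * m) * exp (- (s * D t \<omega>)))"
  proof (rule integral_mono)
    show "integrable M (\<lambda>\<omega>. exp (s * m) * exp (- (s * D t \<omega>)))"
      using exp_D_integrable[OF assms(1,2)] by simp
    show "integrable M (indicat_real {\<omega> \<in> space M. Q \<omega>})"
      using ev by (simp add: P.emeasure_finite less_top[symmetric])
    show "indicat_real {\<omega> \<in> space M. Q \<omega>} \<omega> \<le> exp (s * m) * exp (- (s * D t \<omega>))" if "\<omega> \<in> space M" for \<omega>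
      using mult_left_mono[OF Q[OF that] assms(2)] by (auto simp: indicator_def exp_add[symmetric])
  qed
  also have "\<dots> = exp (s * m - t * s powr \<beta>)"
    using laplace_D[OF assms(1,2)] by (simp add: exp_add[symmetric] exp_diff exp_minus divide_inverse)
  finally show ?thesis .
qed

text \<open>
  The Laplace transform \<open>e\<^bsup>-ts\<^sup>\<beta>\<^esup>\<close> of \<open>D(t)\<close> tends to \<open>0\<close> as \<open>s \<rightarrow> \<infinity>\<close>, so there is no mass at \<open>0\<close>.
\<close>

lemma D_pos:
  assumes t: "0 < t" shows "AE \<omega> in M. 0 < D t \<omega>"
proof -
  have t': "0 \<le> t" using t by simp
  note D_meas[OF t', measurable]
  have ev: "{\<omega> \<in> space M. D t \<omega> \<le> 0} \<in> sets M" by measurable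
  have "AE \<omega> in M. \<not> D t \<omega> \<le> 0"
  proof (rule P.AE_not_if_prob_vanishes[OF ev, where F=at_top])
    show "((\<lambda>s::real. exp (s * 0 - t * s powr \<beta>)) \<longlongrightarrow> 0) at_top"
      using t \<beta> by real_asymp
    show "eventually (\<lambda>s. P.prob {\<omega> \<in> space M. D t \<omega> \<le> 0} \<le> exp (s * 0 - t * s powr \<beta>)) at_top"
      using eventually_ge_at_top[of 0] by eventually_elim (rule prob_le_exp[OF t' _ ev], auto)
  qed simp
  then show ?thesis by (simp add: not_le)
qed

text \<open>
  The bound of \<open>prob_le_exp\<close> at \<open>s = 1\<close> is \<open>e\<^bsup>m - n\<^esup>\<close>, which vanishes as \<open>n \<rightarrow> \<infinity>\<close>.
\<close>

lemma D_unbounded: "AE \<omega> in M. \<forall>m::nat. \<exists>n::nat. real m < D (real n) \<omega>"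
  unfolding AE_all_countable
proof
  fix m :: nat
  note D_meas[OF of_nat_0_le_iff, measurable]
  have ev: "{\<omega> \<in> space M. \<forall>n::nat. D (real n) \<omega> \<le> real m} \<in> sets M" by measurable
  have "AE \<omega> in M. \<not> (\<forall>n::nat. D (real n) \<omega> \<le> real m)"
  proof (rule P.AE_not_if_prob_vanishes[OF ev, where F=sequentially])
    show "(\<lambda>n. exp (1 * real m - real n * 1 powr \<beta>)) \<longlonglongrightarrow> 0"
      by real_asymp
    show "eventually (\<lambda>n. P.prob {\<omega> \<in> space M. \<forall>n::nat. D (real n) \<omega> \<le> real m} \<le> exp (1 * real m - real n * 1 powr \<beta>)) sequentially"
      by (intro always_eventually allI prob_le_exp[OF of_nat_0_le_iff _ ev]) auto
  qed simp
  then show "AE \<omega> in M. \<exists>n::nat. real m < D (real n) \<omega>" by (simp add: not_le)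
qed

lemma D_increment_pos:
  assumes "0 \<le> q" "q < r" shows "AE \<omega> in M. D q \<omega> < D r \<omega>"
proof -
  let ?Z = "\<lambda>t \<omega>. (A t \<omega>, D t \<omega>)"
  have h: "0 \<le> r - q" and r: "0 \<le> r" using assms by auto
  have "distr M borel (\<lambda>\<omega>. ?Z (q + (r - q)) \<omega> - ?Z q \<omega>) = distr M borel (?Z (r - q))"
    using levy assms(1) h unfolding P.levy_process_def by blast
  note eq = this
  have S: "{z \<in> space borel. 0 < snd (z :: 'b \<times> real)} \<in> sets borel"
    by (simp, intro borel_open open_Collect_less continuous_intros)
  have Z: "(\<lambda>\<omega>. ?Z (q + (r - q)) \<omega> - ?Z q \<omega>) \<in> borel_measurable M"
    using pair_meas[OF r] pair_meas[OF assms(1)] by (intro borel_measurable_diff) auto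
  have "(AE \<omega> in M. 0 < snd (?Z (q + (r - q)) \<omega> - ?Z q \<omega>)) \<longleftrightarrow> (AE \<omega> in M. 0 < snd (?Z (r - q) \<omega>))"
    using AE_distr_iff[OF Z S] AE_distr_iff[OF pair_meas[OF h] S] unfolding eq by blast
  then show ?thesis using D_pos[of "r - q"] assms by simp
qed

theorem regular_paths:
  "AE \<omega> in M. cadlag (\<lambda>t. A t \<omega>) \<and> clock_path (\<lambda>t. D t \<omega>)"
proof -
  have mono: "AE \<omega> in M. \<forall>q\<in>\<rat>. \<forall>r\<in>\<rat>. 0 \<le> q \<longrightarrow> q < r \<longrightarrow> D q \<omega> < D r \<omega>"
    unfolding AE_ball_countable[OF countable_rat]
    using D_increment_pos by (auto intro!: AE_I2 simp: AE_impI)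
  have cadlag: "AE \<omega> in M. cadlag (\<lambda>t. (A t \<omega>, D t \<omega>))" and zero: "AE \<omega> in M. (A 0 \<omega>, D 0 \<omega>) = 0"
    using levy by (auto simp: P.levy_process_def)
  from cadlag zero mono D_unbounded show ?thesis
  proof eventually_elim
    case (elim \<omega>)
    have "clock_path (\<lambda>t. D t \<omega>)"
    proof (rule clock_pathI)
      show "cadlag (\<lambda>t. D t \<omega>)" by (rule cadlag_fst_snd[OF elim(1)])
      show "D 0 \<omega> = 0" using elim(2) by (simp add: zero_prod_def)
      show "\<And>q r. q \<in> \<rat> \<Longrightarrow> r \<in> \<rat> \<Longrightarrow> 0 \<le> q \<Longrightarrow> q < r \<Longrightarrow> D q \<omega> < D r \<omega>"
        using elim(3) by blast
      show "\<And>m::nat. \<exists>n::nat. real m < D (real n) \<omega>" using elim(4) by blast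
    qed
    then show ?case using cadlag_fst_snd(1)[OF elim(1)] by blast
  qed
qed

lemma factor:
  assumes "0 \<le> u" "0 \<le> h" "0 \<le> s" "g \<in> borel_measurable borel" "\<And>z. norm (g z) \<le> B"
  shows "(LINT \<omega>|M. exp (of_real (- s * D u \<omega>) + \<i> * of_real (k \<bullet> A u \<omega>)) *
                   g (A (u + h) \<omega> - A u \<omega>, D (u + h) \<omega> - D u \<omega>)) =
      exp (- (of_real u * \<psi> k s)) * (LINT \<omega>|M. g (A h \<omega>, D h \<omega>) :: complex)"
proof -
  note pair_meas[OF assms(1), measurable] pair_meas[OF assms(2), measurable] assms(4)[measurable]
  note A_meas[OF assms(1), measurable] D_meas[OF assms(1), measurable]
  have f: "(\<lambda>z. exp (of_real (- s * snd z) + \<i> * of_real (k \<bullet> fst z)) :: complex) \<in> borel_measurable (borel :: ('b \<times> real) measure)"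
    by (intro borel_measurable_continuous_onI continuous_intros)
  have "integrable M (\<lambda>\<omega>. exp (of_real (- s * D u \<omega>) + \<i> * of_real (k \<bullet> A u \<omega>)) :: complex)"
  proof (rule P.integrable_const_bound[where B=1])
    show "AE \<omega> in M. norm (exp (of_real (- s * D u \<omega>) + \<i> * of_real (k \<bullet> A u \<omega>)) :: complex) \<le> 1"
      using nonneg by eventually_elim (use assms in auto)
  qed measurable
  moreover have "integrable M (\<lambda>\<omega>. g (A h \<omega>, D h \<omega>))"
    using assms(5) by (intro P.integrable_const_bound[where B=B]) (auto intro!: AE_I2)
  ultimately show ?thesis
    using P.levy_process_factor[OF levy assms(1,2) f assms(4)] transform[OF assms(1,3)] by simp
qed

text \<open>
  On the exceptional null set, \<open>A\<close> is replaced by \<open>0\<close> and \<open>D\<close> by the identity, which is a strictly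
  increasing clock.
\<close>

theorem regular_modification:
  obtains A' D' N where "N \<in> null_sets M" "regular_walk \<Lambda> \<beta> M A' D'"
    "\<And>\<omega> t. \<omega> \<notin> N \<Longrightarrow> A' t \<omega> = A t \<omega>" "\<And>\<omega> t. \<omega> \<notin> N \<Longrightarrow> D' t \<omega> = D t \<omega>"
proof -
  obtain N where N: "{\<omega> \<in> space M. \<not> (cadlag (\<lambda>t. A t \<omega>) \<and> clock_path (\<lambda>t. D t \<omega>))} \<subseteq> N" "N \<in> null_sets M"
    using regular_paths unfolding eventually_ae_filter by blast
  then have N_sets [measurable]: "N \<in> sets M" by auto
  define A' where "A' t \<omega> = (if \<omega> \<in> N then 0 else A t \<omega>)" for t \<omega>
  define D' where "D' t \<omega> = (if \<omega> \<in> N then t else D t \<omega>)" for t \<omega>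
  have A'_meas: "A' t \<in> borel_measurable M" if "0 \<le> t" for t
    using A_meas[OF that] unfolding A'_def[abs_def] by measurable
  have D'_meas: "D' t \<in> borel_measurable M" if "0 \<le> t" for t
    using D_meas[OF that] unfolding D'_def[abs_def] by measurable
  have "regular_walk \<Lambda> \<beta> M A' D'"
  proof unfold_locales
    fix \<omega> assume "\<omega> \<in> space M"
    then show "cadlag (\<lambda>t. A' t \<omega>)" and "clock_path (\<lambda>t. D' t \<omega>)"
      using N(1) by (cases "\<omega> \<in> N"; auto simp: A'_def D'_def cadlag_const clock_path_id)+
  next
    fix u h s B :: real and k :: 'b and g :: "'b \<times> real \<Rightarrow> complex"
    assume as: "0 \<le> u" "0 \<le> h" "0 \<le> s" and g [measurable]: "g \<in> borel_measurable borel" and B: "\<And>z. norm (g z) \<le> B"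
    have uh: "0 \<le> u + h" using as by simp
    note A'_meas[OF as(1), measurable] A'_meas[OF as(2), measurable] A'_meas[OF uh, measurable]
      D'_meas[OF as(1), measurable] D'_meas[OF as(2), measurable] D'_meas[OF uh, measurable]
      A_meas[OF as(1), measurable] A_meas[OF as(2), measurable] A_meas[OF uh, measurable]
      D_meas[OF as(1), measurable] D_meas[OF as(2), measurable] D_meas[OF uh, measurable]
    have 1: "(LINT \<omega>|M. exp (of_real (- s * D' u \<omega>) + \<i> * of_real (k \<bullet> A' u \<omega>)) *
                   g (A' (u + h) \<omega> - A' u \<omega>, D' (u + h) \<omega> - D' u \<omega>)) =
        (LINT \<omega>|M. exp (of_real (- s * D u \<omega>) + \<i> * of_real (k \<bullet> A u \<omega>)) *
                   g (A (u + h) \<omega> - A u \<omega>, D (u + h) \<omega> - D u \<omega>))"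
      by (rule integral_cong_AE)
         (measurable, use AE_not_in[OF N(2)] in \<open>auto simp: A'_def D'_def elim!: eventually_mono\<close>)
    have 2: "(LINT \<omega>|M. g (A' h \<omega>, D' h \<omega>)) = (LINT \<omega>|M. g (A h \<omega>, D h \<omega>))"
      by (rule integral_cong_AE)
         (measurable, use AE_not_in[OF N(2)] in \<open>auto simp: A'_def D'_def elim!: eventually_mono\<close>)
    show "(LINT \<omega>|M. exp (of_real (- s * D' u \<omega>) + \<i> * of_real (k \<bullet> A' u \<omega>)) *
                   g (A' (u + h) \<omega> - A' u \<omega>, D' (u + h) \<omega> - D' u \<omega>)) =
        exp (- (of_real u * \<psi> k s)) * (LINT \<omega>|M. g (A' h \<omega>, D' h \<omega>))"
      unfolding 1 2 by (rule factor[OF as g B])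
  qed (use A'_meas D'_meas in auto)
  with N(2) show thesis
    by (rule that) (auto simp: A'_def D'_def)
qed

text \<open>
  The laws of \<open>L(t)\<close> are unchanged by the modification. They may be computed under \<open>M\<close> instead of its
  completion because \<open>walk_version\<close> is measurable with respect to \<open>M\<close>.
\<close>

theorem walk_mild_solution:
  assumes density: "\<And>t. 0 < t \<Longrightarrow>
      distributed (completion M) lborel (\<lambda>\<omega>. levy_walk (\<lambda>r. A r \<omega>) (\<lambda>r. D r \<omega>) t) (\<rho> t)"
  shows "mild_solution \<psi> (walk_rhs \<beta> \<Lambda>) (\<lambda>t. density lborel (\<rho> t))"
proof -
  obtain A' D' N where N: "N \<in> null_sets M" and reg: "regular_walk \<Lambda> \<beta> M A' D'"
    and A': "\<And>\<omega> t. \<omega> \<notin> N \<Longrightarrow> A' t \<omega> = A t \<omega>" and D': "\<And>\<omega> t. \<omega> \<notin> N \<Longrightarrow> D' t \<omega> = D t \<omega>"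
    by (rule regular_modification) blast
  interpret R: regular_walk \<Lambda> \<beta> M A' D' by (rule reg)
  let ?L = "\<lambda>t \<omega>. levy_walk (\<lambda>r. A r \<omega>) (\<lambda>r. D r \<omega>) t"
  have law: "density lborel (\<rho> t) = distr (completion M) lborel (?L t)" if "0 < t" for t
    using density[OF that] by (simp add: distributed_def)
  have L_meas: "?L t \<in> borel_measurable (completion M)" if "0 < t" for t
    using density[OF that] by (simp add: distributed_def)
  have "prob_space (density lborel (\<rho> t))" if "0 < t" for t
    unfolding law[OF that]
    by (rule prob_space.prob_space_distr[OF P.prob_space_completion]) (use L_meas[OF that] in simp)
  moreover have ft: "fourier_transform (density lborel (\<rho> t)) k = (LINT \<omega>|M. exp (\<i> * of_real (k \<bullet> R.walk_version t \<omega>)))"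
    if t: "0 < t" for t k
  proof -
    note L_meas[OF t, measurable] measurable_completion[OF R.walk_version_measurable_time[of t], measurable]
    have "fourier_transform (density lborel (\<rho> t)) k = (LINT \<omega>|completion M. exp (\<i> * of_real (k \<bullet> ?L t \<omega>)))"
      unfolding fourier_transform_def law[OF t] by (rule integral_distr) measurable
    also have "\<dots> = (LINT \<omega>|completion M. exp (\<i> * of_real (k \<bullet> R.walk_version t \<omega>)))"
    proof (rule integral_cong_AE)
      have "AE \<omega> in M. exp (\<i> * complex_of_real (k \<bullet> ?L t \<omega>)) = exp (\<i> * of_real (k \<bullet> R.walk_version t \<omega>))"
        using AE_not_in[OF N] AE_space
      proof eventually_elim
        case (elim \<omega>)
        have "?L t \<omega> = R.walk t \<omega>" using elim(1) by (simp add: A' D')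
        then show ?case using R.walk_eq_version[OF elim(2), of t] t by simp
      qed
      then show "AE \<omega> in completion M. exp (\<i> * complex_of_real (k \<bullet> ?L t \<omega>)) = exp (\<i> * of_real (k \<bullet> R.walk_version t \<omega>))"
        by (rule AE_completion)
    qed measurable
    also have "\<dots> = (LINT \<omega>|M. exp (\<i> * of_real (k \<bullet> R.walk_version t \<omega>)))"
      by (rule integral_completion) measurable
    finally show ?thesis .
  qed
  moreover have "fourier_laplace_exists (\<lambda>t. density lborel (\<rho> t)) k s"
    and "\<psi> k s * fourier_laplace (\<lambda>t. density lborel (\<rho> t)) k s = \<phi> k s" if s: "0 < s" for k s
  proof -
    show "fourier_laplace_exists (\<lambda>t. density lborel (\<rho> t)) k s"
      using R.walk_fourier_laplace(1)[OF s, of k] unfolding fourier_laplace_exists_def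
      by (subst set_integrable_cong[OF refl refl]) (auto simp: ft)
    have "fourier_laplace (\<lambda>t. density lborel (\<rho> t)) k s =
        (LINT t:{0<..}|lborel. of_real (exp (- s * t)) * (LINT \<omega>|M. exp (\<i> * of_real (k \<bullet> R.walk_version t \<omega>))))"
      unfolding fourier_laplace_def by (rule set_lebesgue_integral_cong) (auto simp: ft)
    then show "\<psi> k s * fourier_laplace (\<lambda>t. density lborel (\<rho> t)) k s = \<phi> k s"
      using R.walk_fourier_laplace(2)[OF s, of k] by simp
  qed
  ultimately show ?thesis
    unfolding mild_solution_def
    using walk_rhs_weakly_measurable walk_rhs_transform by auto
qed

end

theorem theorem5p6:
  fixes \<beta> :: real
    and \<Lambda> :: "(real ^ 'm) measure"
    and M :: "'w measure"
    and A :: "real \<Rightarrow> 'w \<Rightarrow> real ^ 'm"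
    and D :: "real \<Rightarrow> 'w \<Rightarrow> real"
    and \<rho> :: "real \<Rightarrow> real ^ 'm \<Rightarrow> ennreal"
  assumes "0 < \<beta>" and "\<beta> < 1"
    and "prob_space \<Lambda>"
    and "sets \<Lambda> = sets (restrict_space borel (sphere 0 1))"
    and "span (measure_support \<Lambda>) = UNIV"
    and "prob_space M"
    and "prob_space.levy_process M (\<lambda>t \<omega>. (A t \<omega>, D t \<omega>))"
    and "AE \<omega> in M. \<forall>t\<ge>0. 0 \<le> D t \<omega>"
    and "\<And>t k s. 0 \<le> t \<Longrightarrow> 0 \<le> s \<Longrightarrow>
           (LINT \<omega>|M. exp (complex_of_real (- s * D t \<omega>) + \<i> * complex_of_real (k \<bullet> A t \<omega>)))
           = exp (- (complex_of_real t * walk_symbol \<beta> \<Lambda> k s))"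
    and "\<And>t. 0 < t \<Longrightarrow>
           distributed (completion M) lborel
             (\<lambda>\<omega>. levy_walk (\<lambda>r. A r \<omega>) (\<lambda>r. D r \<omega>) t) (\<rho> t)"
  shows "mild_solution (walk_symbol \<beta> \<Lambda>) (walk_rhs \<beta> \<Lambda>) (\<lambda>t. density lborel (\<rho> t))"
proof -
  interpret \<Lambda>: prob_space \<Lambda> by fact
  interpret M: prob_space M by fact
  interpret walk_process \<Lambda> \<beta> M A D
    by unfold_locales (fact assms)+
  show ?thesis
    by (rule walk_mild_solution) (fact assms(10))
qed

end
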